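(* Let $p$ be a prime and let $L=\partial+a$ be a first order linear differential operator with $a$ a rational function in $\mathbb{F}_p(x)$ or an algebraic series in $\mathbb{F}_p((x))$ (i.e. algebraic over $\mathbb{F}_p(x)$). Assume that $L$ has a regular singularity at $0$ and local exponent $\rho=0$. Then, for every $k\in\mathbb{N}$, there exists a series $h_k\in 1+x^{p^k}w_k\,\mathcal{S}_p^{(k)}$, algebraic over $\mathbb{F}_p(x,z_1,\ldots,z_k)$, such that $y=\prod_{k=0}^\infty h_k$ is a solution of $Ly=0$. In particular, $\pi_i(y)=\prod_{k=0}^i h_k$ is algebraic over $\mathbb{F}_p(x,z_1,\ldots,z_i)$ for all $i\in\mathbb{N}$.
   Context: $\mathbb{N}=\{0,1,2,\ldots\}$. $\mathcal{R}_p=\mathbb{F}_p(z_1,z_2,\ldots)((x))$ is the field of formal Laurent series in $x$ whose coefficients are rational functions over $\mathbb{F}_p$ in countably many variables $z_i$ (each single coefficient involves only finitely many of them), with the $\mathbb{F}_p$-derivation $\partial$ (also written $y\mapsto y'$), acting termwise on series in $x$, given by $\partial x=1$, $\partial z_1=\frac1x$, $\partial z_i=\frac{1}{xz_1\cdots z_{i-1}}$ for $i\ge2$. $Ly=y'+ay$, and solutions are understood in $\mathcal{R}_p$. Put $\mathcal{R}_p^{(k)}=\mathbb{F}_p(z_1,\ldots,z_k)((x))$ and, for $k\ge0$, $w_k=z_1^{p^{k-1}}z_2^{p^{k-2}}\cdots z_{k-1}^{p}z_k$ (so $w_0=1$, $w_1=z_1$, $w_2=z_1^pz_2$). $\mathcal{S}_p$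 is the closure of $\mathbb{F}_p[x,x^pw_1,x^{p^2}w_2,\ldots]$ in $\mathcal{R}_p$ for the $x$-adic topology, and $\mathcal{S}_p^{(k)}=\mathcal{S}_p\cap\mathcal{R}_p^{(k)}$. The projection $\pi_i$ on series in $x$ with coefficients polynomial in the $z_j$ sets $z_{i+1}=z_{i+2}=\cdots=0$. Infinite products converge in the $x$-adic topology. $L=\partial+a$ has a regular singularity at $0$ if $a$ has a pole of order at most $1$ at $0$; the local exponent is the root of the indicial polynomial, i.e. minus the coefficient of $x^{-1}$ in $a$. *)

theory Defs
  imports
    "HOL-Analysis.Infinite_Products"
    "HOL-Library.Poly_Mapping"
    "HOL-Computational_Algebra.Computational_Algebra"
    "Berlekamp_Zassenhaus.Finite_Field"
begin

notation fls_nth (infixl \<open>$$\<close> 75)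

section \<open>Subrings and subfields generated by a set, algebraic elements\<close>

inductive_set ring_gen :: "'a::comm_ring_1 set \<Rightarrow> 'a set" for A :: "'a set" where
  base: "a \<in> A \<Longrightarrow> a \<in> ring_gen A"
| one: "1 \<in> ring_gen A"
| diff: "a \<in> ring_gen A \<Longrightarrow> b \<in> ring_gen A \<Longrightarrow> a - b \<in> ring_gen A"
| mult: "a \<in> ring_gen A \<Longrightarrow> b \<in> ring_gen A \<Longrightarrow> a * b \<in> ring_gen A"

inductive_set field_gen :: "'a::field set \<Rightarrow> 'a set" for A :: "'a set" where
  base: "a \<in> A \<Longrightarrow> a \<in> field_gen A"
| one: "1 \<in> field_gen A"
| diff: "a \<in> field_gen A \<Longrightarrow> b \<in> field_gen A \<Longrightarrow> a - b \<in> field_gen A"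
| mult: "a \<in> field_gen A \<Longrightarrow> b \<in> field_gen A \<Longrightarrow> a * b \<in> field_gen A"
| inv: "a \<in> field_gen A \<Longrightarrow> inverse a \<in> field_gen A"

definition algebraic_over :: "'a::field set \<Rightarrow> 'a \<Rightarrow> bool" where
  "algebraic_over F y \<longleftrightarrow> (\<exists>P. P \<noteq> 0 \<and> (\<forall>i. Polynomial.coeff P i \<in> F) \<and> poly P y = 0)"


section \<open>The coefficient field \<open>\<bbbF>\<^sub>p(z\<^sub>1, z\<^sub>2, \<dots>)\<close>\<close>

text \<open>
  The prime is \<open>p = CARD('p)\<close> with \<open>'p :: prime_card\<close>.  Variables are numbered from \<open>0\<close>:
  \<open>zc j\<close> stands for \<open>z\<^sub>j\<^sub>+\<^sub>1\<close>, so that \<open>z\<^sub>1, \<dots>, z\<^sub>k\<close> are the \<open>zc j\<close> with \<open>j < k\<close>.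
  A monomial is its finitely supported exponent vector.
\<close>

type_synonym 'p zpoly = "(nat \<Rightarrow>\<^sub>0 nat) \<Rightarrow>\<^sub>0 'p mod_ring"
type_synonym 'p zrat = "'p zpoly fract"

definition zc :: "nat \<Rightarrow> 'p::prime_card zrat" where
  "zc j = to_fract (Poly_Mapping.single (Poly_Mapping.single j 1) 1)"

definition zpoly_subst :: "(nat \<Rightarrow> 'p::prime_card zrat) \<Rightarrow> 'p zpoly \<Rightarrow> 'p zrat" where
  "zpoly_subst \<sigma> P = (\<Sum>m\<in>Poly_Mapping.keys P.
     to_fract (Poly_Mapping.single 0 (Poly_Mapping.lookup P m)) *
     (\<Prod>j\<in>Poly_Mapping.keys m. \<sigma> j ^ Poly_Mapping.lookup m j))"

text \<open>
  Since \<open>\<partial>z\<^sub>i\<close> is \<open>1/x\<close> times an element of the coefficient field, \<open>\<partial>\<close> acts on a coefficient \<open>c\<close>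
  as \<open>\<partial>c = \<delta>c / x\<close>, with \<open>\<delta>\<close> the derivation of the coefficient field such that
  \<open>\<delta>z\<^sub>i = 1/(z\<^sub>1\<cdots>z\<^sub>i\<^sub>-\<^sub>1)\<close>.  As \<open>\<delta>z\<^sub>i/z\<^sub>i = 1/(z\<^sub>1\<cdots>z\<^sub>i)\<close>, a monomial \<open>m\<close> with exponents \<open>m\<^sub>i\<close> has
  logarithmic derivative \<open>\<Sum>i. m\<^sub>i/(z\<^sub>1\<cdots>z\<^sub>i)\<close>; fractions use the quotient rule.  The lemmas
  \<open>delta_add\<close>, \<open>delta_mult\<close>, \<open>delta_zc\<close> below confirm that this is the intended derivation.
\<close>

definition delta_log :: "(nat \<Rightarrow>\<^sub>0 nat) \<Rightarrow> 'p::prime_card zrat" where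
  "delta_log m =
     (\<Sum>j\<in>Poly_Mapping.keys m. of_nat (Poly_Mapping.lookup m j) * inverse (\<Prod>i\<le>j. zc i))"

definition delta_poly :: "'p::prime_card zpoly \<Rightarrow> 'p zrat" where
  "delta_poly P = (\<Sum>m\<in>Poly_Mapping.keys P.
     to_fract (Poly_Mapping.single m (Poly_Mapping.lookup P m)) * delta_log m)"

lemma delta_poly_superset:
  assumes "finite M" "Poly_Mapping.keys P \<subseteq> M"
  shows "delta_poly P =
    (\<Sum>m\<in>M. to_fract (Poly_Mapping.single m (Poly_Mapping.lookup P m)) * delta_log m)"
  unfolding delta_poly_def using assms
  by (intro sum.mono_neutral_left) (auto simp: in_keys_iff)

lemma delta_poly_add: "delta_poly (P + Q) = delta_poly P + delta_poly Q"
proof -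
  let ?M = "Poly_Mapping.keys P \<union> Poly_Mapping.keys Q"
  have "Poly_Mapping.keys (P + Q) \<subseteq> ?M" by (rule keys_add)
  then show ?thesis
    by (simp add: delta_poly_superset[of ?M] lookup_add single_add algebra_simps sum.distrib)
qed

lemma delta_poly_0 [simp]: "delta_poly 0 = 0"
  by (simp add: delta_poly_def)

lemma delta_poly_single:
  "delta_poly (Poly_Mapping.single m c) = to_fract (Poly_Mapping.single m c) * delta_log m"
  by (simp add: delta_poly_def)

lemma delta_poly_1: "delta_poly 1 = 0"
  by (simp flip: single_one add: delta_poly_single) (simp add: delta_log_def)

lemma delta_log_add: "delta_log (m + n) = delta_log m + delta_log n"
proof -
  let ?M = "Poly_Mapping.keys m \<union> Poly_Mapping.keys n"
  have *: "delta_log k =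
      (\<Sum>j\<in>?M. of_nat (Poly_Mapping.lookup k j) * inverse (\<Prod>i\<le>j. zc i))"
    if "Poly_Mapping.keys k \<subseteq> ?M" for k
    unfolding delta_log_def using that
    by (intro sum.mono_neutral_left) (auto simp: in_keys_iff)
  have "Poly_Mapping.keys (m + n) \<subseteq> ?M" by (rule keys_add)
  then show ?thesis
    by (simp add: * lookup_add algebra_simps sum.distrib)
qed

lemma zpoly_induct:
  fixes P :: "'p::prime_card zpoly"
  assumes "Q 0" "\<And>m c. Q (Poly_Mapping.single m c)" "\<And>A B. Q A \<Longrightarrow> Q B \<Longrightarrow> Q (A + B)"
  shows "Q P"
proof -
  have "P = (\<Sum>m\<in>Poly_Mapping.keys P. Poly_Mapping.single m (Poly_Mapping.lookup P m))"
    by (rule poly_mapping_eqI)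
      (simp add: lookup_sum lookup_single when_def in_keys_iff sum.delta)
  moreover have "Q (\<Sum>m\<in>M. Poly_Mapping.single m (Poly_Mapping.lookup P m))" for M
    by (induction M rule: infinite_finite_induct) (auto intro: assms)
  ultimately show ?thesis by metis
qed

lemma delta_poly_mult:
  "delta_poly (P * Q) = delta_poly P * to_fract Q + to_fract P * delta_poly Q"
proof (induction P rule: zpoly_induct)
  case (2 m c)
  show ?case
  proof (induction Q rule: zpoly_induct)
    case (2 n d)
    show ?case
      by (simp add: mult_single delta_poly_single delta_log_add algebra_simps
          flip: to_fract_mult)
  qed (simp_all add: delta_poly_add algebra_simps)
qed (simp_all add: delta_poly_add algebra_simps)

lemma quotient_rule_aux:
  fixes p q p' q' dp dq dp' dq' :: "'a::idom"
  assumes e1: "p * q' = p' * q" and e2: "dp * q' + p * dq' = dp' * q + p' * dq"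
  shows "(dp * q - p * dq) * q' ^ 2 = (dp' * q' - p' * dq') * q ^ 2"
proof -
  have "(dp * q - p * dq) * q' ^ 2 - (dp' * q' - p' * dq') * q ^ 2 =
      q * q' * ((dp * q' + p * dq') - (dp' * q + p' * dq))
      - (q' * dq + q * dq') * (p * q' - p' * q)"
    by (simp add: algebra_simps power2_eq_square)
  also have "\<dots> = 0"
    by (simp add: e1 e2)
  finally show ?thesis by simp
qed

lemma delta_quotient_respects:
  assumes "Q \<noteq> 0" "Q' \<noteq> 0" and eq: "P * Q' = P' * Q"
  shows "(delta_poly P * to_fract Q - to_fract P * delta_poly Q) / to_fract Q ^ 2 =
         (delta_poly P' * to_fract Q' - to_fract P' * delta_poly Q') / to_fract Q' ^ 2"
proof -
  let ?P = "to_fract P" and ?Q = "to_fract Q" and ?P' = "to_fract P'" and ?Q' = "to_fract Q'"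
  have e1: "?P * ?Q' = ?P' * ?Q"
    using eq by (metis to_fract_mult)
  have e2: "delta_poly P * ?Q' + ?P * delta_poly Q' = delta_poly P' * ?Q + ?P' * delta_poly Q"
    using arg_cong[OF eq, of delta_poly] by (simp add: delta_poly_mult)
  have "(delta_poly P * ?Q - ?P * delta_poly Q) * ?Q' ^ 2 =
        (delta_poly P' * ?Q' - ?P' * delta_poly Q') * ?Q ^ 2"
    by (rule quotient_rule_aux[OF e1 e2])
  with assms(1,2) show ?thesis
    by (simp add: frac_eq_eq)
qed

definition delta :: "'p::prime_card zrat \<Rightarrow> 'p zrat" where
  "delta q = (THE r. \<exists>P Q. Q \<noteq> 0 \<and> q = Fraction_Field.Fract P Q \<and>
     r = (delta_poly P * to_fract Q - to_fract P * delta_poly Q) / to_fract Q ^ 2)"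

lemma delta_Fract:
  assumes "Q \<noteq> 0"
  shows "delta (Fraction_Field.Fract P Q) =
    (delta_poly P * to_fract Q - to_fract P * delta_poly Q) / to_fract Q ^ 2"
  unfolding delta_def
proof (rule the_equality)
  show "\<exists>P' Q'. Q' \<noteq> 0 \<and> Fraction_Field.Fract P Q = Fraction_Field.Fract P' Q' \<and>
      (delta_poly P * to_fract Q - to_fract P * delta_poly Q) / to_fract Q ^ 2 =
      (delta_poly P' * to_fract Q' - to_fract P' * delta_poly Q') / to_fract Q' ^ 2"
    using assms by blast
next
  fix r
  assume "\<exists>P' Q'. Q' \<noteq> 0 \<and> Fraction_Field.Fract P Q = Fraction_Field.Fract P' Q' \<and>
      r = (delta_poly P' * to_fract Q' - to_fract P' * delta_poly Q') / to_fract Q' ^ 2"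
  then obtain P' Q' where "Q' \<noteq> 0" "P * Q' = P' * Q"
    and r: "r = (delta_poly P' * to_fract Q' - to_fract P' * delta_poly Q') / to_fract Q' ^ 2"
    using assms by (auto simp: eq_fract)
  then show "r = (delta_poly P * to_fract Q - to_fract P * delta_poly Q) / to_fract Q ^ 2"
    using delta_quotient_respects[of Q Q' P P'] assms by simp
qed

lemma delta_to_fract: "delta (to_fract P) = delta_poly P"
  by (simp add: to_fract_def delta_Fract delta_poly_1 flip: One_fract_def)

lemma delta_divide:
  "Q \<noteq> 0 \<Longrightarrow> delta (to_fract P / to_fract Q) =
     (delta_poly P * to_fract Q - to_fract P * delta_poly Q) / to_fract Q ^ 2"
  using delta_Fract[of Q P] by (simp add: to_fract_def One_fract_def[symmetric] eq_fract)

lemma zrat_cases: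
  obtains P Q where "q = to_fract P / to_fract Q" "Q \<noteq> 0"
  by (cases q) (auto simp: to_fract_def eq_fract)

lemma delta_0 [simp]: "delta 0 = 0"
  using delta_to_fract[of 0] by simp

lemma delta_1 [simp]: "delta 1 = 0"
  using delta_to_fract[of 1] by (simp add: delta_poly_1)

lemma delta_add: "delta (q + r) = delta q + delta r"
proof -
  obtain P Q R S where [simp]: "q = to_fract P / to_fract Q" "r = to_fract R / to_fract S"
    and nz: "Q \<noteq> 0" "S \<noteq> 0"
    using zrat_cases[of q] zrat_cases[of r] by metis
  have "q + r = to_fract (P * S + R * Q) / to_fract (Q * S)"
    using nz by (simp add: field_simps)
  then have "delta (q + r) = (delta_poly (P * S + R * Q) * to_fract (Q * S) -
      to_fract (P * S + R * Q) * delta_poly (Q * S)) / to_fract (Q * S) ^ 2"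
    using nz by (simp only: delta_divide mult_eq_0_iff simp_thms)
  also have "\<dots> = delta q + delta r"
    using nz by (simp add: delta_divide delta_poly_add delta_poly_mult)
      (simp add: divide_simps, simp add: algebra_simps power2_eq_square)
  finally show ?thesis .
qed

lemma delta_mult: "delta (q * r) = delta q * r + q * delta r"
proof -
  obtain P Q R S where [simp]: "q = to_fract P / to_fract Q" "r = to_fract R / to_fract S"
    and nz: "Q \<noteq> 0" "S \<noteq> 0"
    using zrat_cases[of q] zrat_cases[of r] by metis
  have "q * r = to_fract (P * R) / to_fract (Q * S)"
    by simp
  then have "delta (q * r) = (delta_poly (P * R) * to_fract (Q * S) -
      to_fract (P * R) * delta_poly (Q * S)) / to_fract (Q * S) ^ 2"
    using nz by (simp only: delta_divide mult_eq_0_iff simp_thms)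
  also have "\<dots> = delta q * r + q * delta r"
    using nz by (simp add: delta_divide delta_poly_mult)
      (simp add: divide_simps, simp add: algebra_simps power2_eq_square)
  finally show ?thesis .
qed

lemma zc_nonzero [simp]: "zc j \<noteq> 0"
  by (simp add: zc_def single_zero flip: to_fract_0)
    (metis lookup_single_eq lookup_zero zero_neq_one)

lemma delta_zc: "delta (zc j :: 'p::prime_card zrat) = inverse (\<Prod>i<j. zc i)"
proof -
  have "delta (zc j) = zc j * inverse (\<Prod>i\<le>j. zc i)"
    by (simp add: zc_def delta_to_fract delta_poly_single) (simp add: delta_log_def zc_def)
  also have "(\<Prod>i\<le>j. zc i) = (\<Prod>i<j. zc i) * (zc j :: 'p zrat)"
    by (simp add: lessThan_Suc_atMost[symmetric])
  finally show ?thesis by simp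
qed


section \<open>The differential field \<open>\<R>\<^sub>p\<close>\<close>

type_synonym 'p Rp = "'p zrat fls"

definition zvar :: "nat \<Rightarrow> 'p::prime_card Rp" where
  "zvar j = fls_const (zc j)"

definition zrat_upto :: "nat \<Rightarrow> 'p::prime_card zrat set" where
  "zrat_upto k = field_gen (zc ` {..<k})"

text \<open>\<open>\<R>\<^sub>p\<^sup>(\<^sup>k\<^sup>) = \<bbbF>\<^sub>p(z\<^sub>1, \<dots>, z\<^sub>k)((x))\<close>; in particular \<open>Rp_upto 0\<close> is \<open>\<bbbF>\<^sub>p((x))\<close>.\<close>

definition Rp_upto :: "nat \<Rightarrow> 'p::prime_card Rp set" where
  "Rp_upto k = {f. \<forall>n. f $$ n \<in> zrat_upto k}"

text \<open>\<open>\<bbbF>\<^sub>p(x, z\<^sub>1, \<dots>, z\<^sub>k)\<close>, as a subfield of \<open>\<R>\<^sub>p\<close>; in particular \<open>ratfun 0\<close> is \<open>\<bbbF>\<^sub>p(x)\<close>.\<close>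

definition ratfun :: "nat \<Rightarrow> 'p::prime_card Rp set" where
  "ratfun k = field_gen (insert fls_X (zvar ` {..<k}))"

definition map_coeffs :: "('a::zero \<Rightarrow> 'a) \<Rightarrow> 'a fls \<Rightarrow> 'a fls" where
  "map_coeffs \<phi> f = Abs_fls (\<lambda>n. \<phi> (f $$ n))"

lemma map_coeffs_nth:
  assumes "\<phi> 0 = 0"
  shows "map_coeffs \<phi> f $$ n = \<phi> (f $$ n)"
  unfolding map_coeffs_def
proof (rule nth_Abs_fls)
  show "\<forall>\<^sub>\<infinity>n. \<phi> (f $$ (- int n)) = 0"
    using MOST_fls_neg_nth_eq_0[of f] by (rule eventually_mono) (simp add: assms)
qed

text \<open>\<open>\<partial>(\<Sum> c\<^sub>n x\<^sup>n) = \<Sum> n c\<^sub>n x\<^sup>n\<^sup>-\<^sup>1 + \<Sum> (\<delta>c\<^sub>n/x) x\<^sup>n\<close>\<close>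

definition Rp_deriv :: "'p::prime_card Rp \<Rightarrow> 'p Rp" where
  "Rp_deriv f = fls_deriv f + fls_X_inv * map_coeffs delta f"

lemma Rp_deriv_X: "Rp_deriv fls_X = (1 :: 'p::prime_card Rp)"
proof -
  have "map_coeffs delta (fls_X :: 'p Rp) = 0"
    by (rule fls_eqI) (simp add: map_coeffs_nth delta_1)
  then show ?thesis
    by (simp add: Rp_deriv_def)
qed

lemma fls_const_prod: "fls_const (prod f A) = (\<Prod>i\<in>A. fls_const (f i :: 'a::comm_semiring_1))"
  by (induction A rule: infinite_finite_induct) (simp_all flip: fls_const_mult_const)

lemma Rp_deriv_zvar: "Rp_deriv (zvar j :: 'p::prime_card Rp) = inverse (fls_X * (\<Prod>i<j. zvar i))"
proof -
  have "map_coeffs delta (zvar j :: 'p Rp) = fls_const (delta (zc j))"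
    by (rule fls_eqI) (simp add: map_coeffs_nth zvar_def)
  also have "\<dots> = inverse (\<Prod>i<j. zvar i)"
    by (simp add: delta_zc zvar_def fls_inverse_const fls_const_prod[symmetric])
  finally have "map_coeffs delta (zvar j :: 'p Rp) = inverse (\<Prod>i<j. zvar i)" .
  then show ?thesis
    by (simp add: Rp_deriv_def) (simp add: zvar_def fls_inverse_X)
qed

lemma map_coeffs_delta_add: "map_coeffs delta (f + g) = map_coeffs delta f + map_coeffs delta g"
  by (rule fls_eqI) (simp add: map_coeffs_nth delta_add)

lemma Rp_deriv_add: "Rp_deriv (f + g) = Rp_deriv f + Rp_deriv g"
  by (simp add: Rp_deriv_def map_coeffs_delta_add algebra_simps)

lemma fls_times_nth_wide:
  fixes f g :: "'a::comm_ring_1 fls"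
  assumes "a \<le> fls_subdegree f" "n - fls_subdegree g \<le> b"
  shows "(f * g) $$ n = (\<Sum>i=a..b. f $$ i * g $$ (n - i))"
  unfolding fls_times_nth(2)
proof (rule sum.mono_neutral_left)
  show "\<forall>i\<in>{a..b} - {fls_subdegree f..n - fls_subdegree g}. f $$ i * g $$ (n - i) = 0"
  proof
    fix i assume "i \<in> {a..b} - {fls_subdegree f..n - fls_subdegree g}"
    then have "i < fls_subdegree f \<or> n - i < fls_subdegree g" by auto
    then show "f $$ i * g $$ (n - i) = 0" by auto
  qed
qed (use assms in auto)

lemma map_coeffs_delta_mult:
  fixes f g :: "'p::prime_card Rp"
  shows "map_coeffs delta (f * g) = map_coeffs delta f * g + f * map_coeffs delta g"
proof (rule fls_eqI)
  fix n
  let ?f' = "map_coeffs delta f" and ?g' = "map_coeffs delta g"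
  define a where "a = min (fls_subdegree f) (fls_subdegree ?f')"
  define b where "b = max (n - fls_subdegree g) (n - fls_subdegree ?g')"
  have delta_sum: "delta (sum F {a..b}) = (\<Sum>i=a..b. delta (F i))" for F :: "int \<Rightarrow> 'p zrat"
    using sum_comp_morphism[of delta F "{a..b}"] by (simp add: delta_add o_def)
  have "map_coeffs delta (f * g) $$ n = delta (\<Sum>i=a..b. f $$ i * g $$ (n - i))"
    by (simp add: map_coeffs_nth) (subst fls_times_nth_wide[of a _ _ _ b]; simp add: a_def b_def)
  also have "\<dots> = (\<Sum>i=a..b. ?f' $$ i * g $$ (n - i)) + (\<Sum>i=a..b. f $$ i * ?g' $$ (n - i))"
    by (simp add: delta_sum delta_mult map_coeffs_nth sum.distrib)
  also have "\<dots> = (?f' * g) $$ n + (f * ?g') $$ n"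
    by (subst (1 2) fls_times_nth_wide[of a _ _ _ b]) (auto simp: a_def b_def)
  finally show "map_coeffs delta (f * g) $$ n = (?f' * g + f * ?g') $$ n"
    by simp
qed

lemma Rp_deriv_mult: "Rp_deriv (f * g) = Rp_deriv f * g + f * Rp_deriv g"
  by (simp add: Rp_deriv_def map_coeffs_delta_mult algebra_simps)


section \<open>The ring \<open>\<S>\<^sub>p\<close> and the projections \<open>\<pi>\<^sub>i\<close>\<close>

definition wmon :: "nat \<Rightarrow> 'p::prime_card Rp" where
  "wmon k = (\<Prod>j<k. zvar j ^ (CARD('p) ^ (k - 1 - j)))"

text \<open>The metric on Laurent series in the library induces the \<open>x\<close>-adic topology; \<open>wmon 0 = 1\<close>
  yields the generator \<open>x\<close>.\<close>

definition Sp :: "'p::prime_card Rp set" where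
  "Sp = closure (ring_gen (range (\<lambda>k. fls_X ^ (CARD('p) ^ k) * wmon k)))"

definition Sp_upto :: "nat \<Rightarrow> 'p::prime_card Rp set" where
  "Sp_upto k = Sp \<inter> Rp_upto k"

definition poly_coeffs :: "'p::prime_card Rp \<Rightarrow> bool" where
  "poly_coeffs f \<longleftrightarrow> (\<forall>n. f $$ n \<in> range to_fract)"

text \<open>The projection \<open>\<pi>\<^sub>i\<close>, meaningful only for series satisfying \<open>poly_coeffs\<close>.\<close>

definition proj :: "nat \<Rightarrow> 'p::prime_card Rp \<Rightarrow> 'p Rp" where
  "proj i = map_coeffs (\<lambda>c. zpoly_subst (\<lambda>j. if j < i then zc j else 0) (the_inv to_fract c))"


section \<open>First order operators \<open>L = \<partial> + a\<close>\<close>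

definition Lop :: "'p::prime_card Rp \<Rightarrow> 'p Rp \<Rightarrow> 'p Rp" where
  "Lop a y = Rp_deriv y + a * y"

definition regular_singularity :: "'p::prime_card Rp \<Rightarrow> bool" where
  "regular_singularity a \<longleftrightarrow> fls_subdegree a \<ge> -1"

text \<open>The root of the indicial polynomial \<open>s + a\<^sub>-\<^sub>1\<close>.\<close>

definition local_exponent :: "'p::prime_card Rp \<Rightarrow> 'p zrat" where
  "local_exponent a = - (a $$ (-1))"

end

theory Submission
  imports Defs
begin

text \<open>
  Let \<open>t\<^sub>0 = x\<close> and \<open>t\<^sub>k = x ^ (p ^ k) w\<^sub>k\<close> be the generators of \<open>\<S>\<^sub>p\<close>.  They satisfy
  \<open>\<partial>t\<^sub>k\<^sub>+\<^sub>1 = t\<^sub>k ^ (p - 1) \<partial>t\<^sub>k\<close> (\<open>deriv_tgen_Suc\<close>): what has no primitive in terms of \<open>t\<^sub>k\<close> in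
  characteristic \<open>p\<close>, namely \<open>t\<^sub>k ^ (p - 1) \<partial>t\<^sub>k\<close>, acquires one through the next variable.  The factors
  \<open>h\<^sub>k\<close> pass an error up this ladder, and their construction keeps the following invariant: the
  product \<open>Y\<^sub>k = h\<^sub>0 \<cdots> h\<^sub>k\<close> satisfies \<open>\<partial>Y\<^sub>k = (- a + b\<^sub>k \<partial>t\<^sub>k\<^sub>+\<^sub>1) Y\<^sub>k\<close> with a constant \<open>b\<^sub>k\<close> that is algebraic over
  \<open>\<bbbF>\<^sub>p(x, z\<^sub>1, \<dots>, z\<^sub>k)\<close>.

  To find \<open>h\<^sub>k\<^sub>+\<^sub>1\<close>, write \<open>t = t\<^sub>k\<^sub>+\<^sub>1\<close> and \<open>b = b\<^sub>k\<close>.  The natural candidate \<open>exp (- t b)\<close> is not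
  available, but there is a substitute.  Put \<open>u = t b\<close> and let \<open>v\<close> be the solution of positive order of
  the Artin--Schreier equation \<open>v = u ^ p + v ^ p\<close>.  Then
  \<open>h = - (\<Sum>i<p. (- u) ^ i (v + i + 1) \<cdots> (v + p - 1))\<close> satisfies \<open>t \<partial>h = - (u + v) h \<partial>t\<close>
  (\<open>d_trunc_exp\<close>): the sum telescopes and leaves the defect \<open>v (v + 1) \<cdots> (v + p - 1) + u ^ p\<close>,
  which is \<open>v ^ p - v + u ^ p = 0\<close>.  Moreover \<open>v = t ^ p g\<close> with \<open>g\<close> constant, so the new error
  \<open>- g t ^ (p - 1) \<partial>t = - g \<partial>t\<^sub>k\<^sub>+\<^sub>2\<close> has the required form with \<open>b\<^sub>k\<^sub>+\<^sub>1 = - g\<close>.  Everything stays algebraic, since \<open>h\<close> is a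
  polynomial in \<open>u\<close> and \<open>v\<close> and \<open>v\<close> is a root of a monic polynomial in \<open>u\<close> (\<open>level_step\<close>).

  At the bottom the coefficient \<open>a\<close> is not a constant.  Being algebraic over \<open>\<bbbF>\<^sub>p(x)\<close>, it can be written
  as \<open>\<Sum>i<p. x ^ i \<alpha>\<^sub>i ^ p\<close> with algebraic \<open>\<alpha>\<^sub>i\<close> (\<open>algebraic_p_decomposition\<close>).  For \<open>i < p - 1\<close> the summand is a
  constant times the derivative of \<open>x ^ (i + 1)\<close> and is treated as above with \<open>t = x ^ (i + 1)\<close>;
  the summand for \<open>i = p - 1\<close> and the errors produced are constant multiples of \<open>\<partial>t\<^sub>1 = x ^ (p - 1)\<close>
  (\<open>base_factor_exists\<close>).

  The errors \<open>b\<^sub>k \<partial>t\<^sub>k\<^sub>+\<^sub>1\<close> have order at least \<open>p ^ (k + 1) - 1\<close>, so the product converges to a solution.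
  Finally, for \<open>k \<ge> 1\<close> the factor \<open>h\<^sub>k\<close> is congruent to \<open>1\<close> modulo \<open>t\<^sub>k\<close>, hence becomes \<open>1\<close> when \<open>z\<^sub>k\<close>
  is set to zero, and it involves no variable beyond \<open>z\<^sub>k\<close>; therefore \<open>\<pi>\<^sub>i\<close> cuts the product off after the factor \<open>h\<^sub>i\<close>.
\<close>

section \<open>Algebraic elements over a subfield\<close>

locale subfield_set =
  fixes F :: "'a::field set"
  assumes one_closed: "1 \<in> F"
    and diff_closed: "x \<in> F \<Longrightarrow> y \<in> F \<Longrightarrow> x - y \<in> F"
    and mult_closed: "x \<in> F \<Longrightarrow> y \<in> F \<Longrightarrow> x * y \<in> F"
    and inverse_closed: "x \<in> F \<Longrightarrow> inverse x \<in> F"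
begin

lemma zero_closed: "0 \<in> F"
  using diff_closed[OF one_closed one_closed] by simp

lemma uminus_closed: "x \<in> F \<Longrightarrow> - x \<in> F"
  using diff_closed[OF zero_closed] by force

lemma add_closed: "x \<in> F \<Longrightarrow> y \<in> F \<Longrightarrow> x + y \<in> F"
  using diff_closed[of x "- y"] uminus_closed by force

lemma divide_closed: "x \<in> F \<Longrightarrow> y \<in> F \<Longrightarrow> x / y \<in> F"
  by (simp add: divide_inverse mult_closed inverse_closed)

lemma sum_closed: "(\<And>i. i \<in> I \<Longrightarrow> f i \<in> F) \<Longrightarrow> sum f I \<in> F"
  by (induction I rule: infinite_finite_induct) (auto intro: zero_closed add_closed)

lemma power_closed: "x \<in> F \<Longrightarrow> x ^ n \<in> F"
  by (induction n) (auto intro: one_closed mult_closed)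

definition span :: "'i set \<Rightarrow> ('i \<Rightarrow> 'a) \<Rightarrow> 'a set" where
  "span I f = {\<Sum>i\<in>I. c i * f i | c. range c \<subseteq> F}"

lemma span_add: "x \<in> span I f \<Longrightarrow> y \<in> span I f \<Longrightarrow> x + y \<in> span I f"
proof -
  assume "x \<in> span I f" "y \<in> span I f"
  then obtain c d where "x = (\<Sum>i\<in>I. c i * f i)" "y = (\<Sum>i\<in>I. d i * f i)"
      "range c \<subseteq> F" "range d \<subseteq> F"
    unfolding span_def by blast
  then show ?thesis
    unfolding span_def
    by (intro CollectI exI[of _ "\<lambda>i. c i + d i"])
      (auto simp: algebra_simps sum.distrib intro!: add_closed)
qed

lemma span_scale: "a \<in> F \<Longrightarrow> x \<in> span I f \<Longrightarrow> a * x \<in> span I f"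
proof -
  assume "a \<in> F" "x \<in> span I f"
  then obtain c where "x = (\<Sum>i\<in>I. c i * f i)" "range c \<subseteq> F"
    unfolding span_def by blast
  with \<open>a \<in> F\<close> show ?thesis
    unfolding span_def
    by (intro CollectI exI[of _ "\<lambda>i. a * c i"])
      (auto simp: algebra_simps sum_distrib_left intro!: mult_closed)
qed

lemma span_zero: "0 \<in> span I f"
  unfolding span_def by (intro CollectI exI[of _ "\<lambda>i. 0"]) (auto intro: zero_closed)

lemma span_diff: "x \<in> span I f \<Longrightarrow> y \<in> span I f \<Longrightarrow> x - y \<in> span I f"
  using span_add[of x I f "- 1 * y"] span_scale[of "- 1" y I f] uminus_closed[OF one_closed] by simp

lemma span_sum: "(\<And>j. j \<in> J \<Longrightarrow> g j \<in> span I f) \<Longrightarrow> sum g J \<in> span I f"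
  by (induction J rule: infinite_finite_induct) (auto intro: span_zero span_add)

lemma span_base:
  assumes "finite I" "i \<in> I"
  shows "f i \<in> span I f"
proof -
  have "(\<Sum>j\<in>I. (if j = i then 1 else 0) * f j) = (\<Sum>j\<in>I. if j = i then f j else 0)"
    by (rule sum.cong) auto
  also have "\<dots> = f i"
    using assms by (simp add: sum.delta)
  finally have "f i = (\<Sum>j\<in>I. (if j = i then 1 else 0) * f j)" ..
  then show ?thesis
    unfolding span_def
    by (intro CollectI exI[of _ "\<lambda>j. if j = i then 1 else 0"])
      (auto intro: one_closed zero_closed)
qed

lemma mult_span_closed:
  assumes "\<And>i. i \<in> I \<Longrightarrow> y * f i \<in> span J g" "x \<in> span I f"
  shows "y * x \<in> span J g"
proof -
  obtain c where c: "x = (\<Sum>i\<in>I. c i * f i)" "range c \<subseteq> F"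
    using assms(2) unfolding span_def by blast
  have "y * x = (\<Sum>i\<in>I. c i * (y * f i))"
    by (simp add: c sum_distrib_left algebra_simps)
  also have "\<dots> \<in> span J g"
    using c by (intro span_sum span_scale assms(1)) auto
  finally show ?thesis .
qed

text \<open>
  Gaussian elimination: if some vector has a nonzero coordinate at a chosen generator, subtracting
  multiples of it removes this generator from the other vectors, and both counts drop by one.
\<close>
lemma more_vectors_than_generators_dependent:
  assumes "finite I" "finite J" "card I < card J" "\<And>j. j \<in> J \<Longrightarrow> g j \<in> span I f"
  obtains c where "range c \<subseteq> F" "\<exists>j\<in>J. c j \<noteq> 0" "(\<Sum>j\<in>J. c j * g j) = 0"
proof -
  have "\<exists>c. range c \<subseteq> F \<and> (\<exists>j\<in>J. c j \<noteq> 0) \<and> (\<Sum>j\<in>J. c j * g j) = 0"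
    using assms
  proof (induction I arbitrary: J g rule: finite_induct)
    case empty
    then have "J \<noteq> {}" "\<forall>j\<in>J. g j = 0"
      by (auto simp: span_def)
    then show ?case
      by (intro exI[of _ "\<lambda>_. 1"]) (auto simp: one_closed)
  next
    case (insert i I)
    have "\<exists>d. d \<in> F \<and> g j - d * f i \<in> span I f" if j: "j \<in> J" for j
    proof -
      obtain c where "g j = (\<Sum>i\<in>insert i I. c i * f i)" "range c \<subseteq> F"
        using insert.prems(3)[OF j] unfolding span_def by blast
      then show ?thesis
        using insert.hyps unfolding span_def by (intro exI[of _ "c i"]) auto
    qed
    then obtain d where d: "\<And>j. j \<in> J \<Longrightarrow> d j \<in> F" "\<And>j. j \<in> J \<Longrightarrow> g j - d j * f i \<in> span I f"
      by metis
    show ?case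
    proof (cases "\<forall>j\<in>J. d j = 0")
      case True
      then show ?thesis
        using insert.IH[of J g] insert.prems(1,2) insert.hyps d(2) by force
    next
      case False
      then obtain k where k: "k \<in> J" "d k \<noteq> 0" by blast
      define r where "r j = d j / d k" for j
      have r: "r j \<in> F" if "j \<in> J" for j
        using d(1) k that by (auto simp: r_def intro: divide_closed)
      have "g j - r j * g k \<in> span I f" if "j \<in> J - {k}" for j
      proof -
        have "g j - r j * g k = (g j - d j * f i) - r j * (g k - d k * f i)"
          using k by (simp add: r_def field_simps)
        then show ?thesis
          using that k d(2) r by (simp only: span_diff span_scale Diff_iff simp_thms)
      qed
      moreover have "card I < card (J - {k})"
        using insert.prems insert.hyps k by simp
      ultimately obtain c where c: "range c \<subseteq> F" "\<exists>j\<in>J - {k}. c j \<noteq> 0"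
          "(\<Sum>j\<in>J - {k}. c j * (g j - r j * g k)) = 0"
        using insert.IH[of "J - {k}" "\<lambda>j. g j - r j * g k"] insert.prems(1) by auto
      define c' where "c' = c(k := - (\<Sum>j\<in>J - {k}. c j * r j))"
      have "(\<Sum>j\<in>J. c' j * g j) = c' k * g k + (\<Sum>j\<in>J - {k}. c j * g j)"
        using k insert.prems(1) by (subst sum.remove[of _ k]) (auto simp: c'_def)
      also have "\<dots> = (\<Sum>j\<in>J - {k}. c j * (g j - r j * g k))"
        by (simp add: c'_def algebra_simps sum_subtractf sum_distrib_left)
      finally have "(\<Sum>j\<in>J. c' j * g j) = 0"
        using c(3) by simp
      moreover have "range c' \<subseteq> F"
        using c(1) r by (auto simp: c'_def intro!: uminus_closed sum_closed mult_closed)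
      moreover have "\<exists>j\<in>J. c' j \<noteq> 0"
        using c(2) by (auto simp: c'_def)
      ultimately show ?thesis by blast
    qed
  qed
  then show ?thesis using that by blast
qed

lemma algebraic_overI:
  assumes "range c \<subseteq> F" "\<exists>i\<le>n. c i \<noteq> 0" "(\<Sum>i\<le>n. c i * y ^ i) = 0"
  shows "algebraic_over F y"
proof -
  define P where "P = (\<Sum>i\<le>n. Polynomial.monom (c i) i)"
  have coeff: "Polynomial.coeff P i = (if i \<le> n then c i else 0)" for i
    by (simp add: P_def coeff_sum coeff_monom)
  have "poly P y = 0"
    using assms(3) by (simp add: P_def poly_sum poly_monom)
  moreover have "P \<noteq> 0"
    using assms(2) coeff by (metis coeff_0)
  moreover have "Polynomial.coeff P i \<in> F" for i
    using assms(1) zero_closed by (auto simp: coeff)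
  ultimately show ?thesis
    unfolding algebraic_over_def by blast
qed

lemma algebraic_overE:
  assumes "algebraic_over F y"
  obtains c n where "range c \<subseteq> F" "y ^ n = (\<Sum>i<n. c i * y ^ i)"
proof -
  obtain P where P: "P \<noteq> 0" "\<And>i. Polynomial.coeff P i \<in> F" "poly P y = 0"
    using assms unfolding algebraic_over_def by blast
  define l where "l = lead_coeff P"
  have l: "l \<noteq> 0" "l \<in> F"
    using P by (auto simp: l_def)
  have "0 = (\<Sum>i<degree P. Polynomial.coeff P i * y ^ i) + l * y ^ degree P"
    using P(3) by (simp add: poly_altdef l_def lessThan_Suc_atMost[symmetric])
  then have "l * y ^ degree P = - (\<Sum>i<degree P. Polynomial.coeff P i * y ^ i)"
    by (simp add: eq_neg_iff_add_eq_0 add.commute)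
  then have "y ^ degree P = - (\<Sum>i<degree P. Polynomial.coeff P i * y ^ i) / l"
    using l(1) by (simp add: field_simps)
  also have "\<dots> = (\<Sum>i<degree P. (- Polynomial.coeff P i / l) * y ^ i)"
    by (simp add: sum_divide_distrib sum_negf)
  finally show ?thesis
    using that[of "\<lambda>i. - Polynomial.coeff P i / l" "degree P"] P(2) l
    by (auto intro!: divide_closed uminus_closed)
qed

text \<open>
  An element \<open>y\<close> is algebraic once some finitely generated subspace containing \<open>1\<close> is stable under
  multiplication by \<open>y\<close>, because there are then more powers of \<open>y\<close> in it than generators.  The
  multipliers of a fixed subspace form a ring, so this criterion makes sums and products of
  algebraic elements algebraic.  Indexing the generators by natural numbers keeps the predicate
  free of an index type.
\<close>
definition finite_module :: "'a set \<Rightarrow> bool" where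
  "finite_module V \<longleftrightarrow> (\<exists>(I :: nat set) f. finite I \<and> V = span I f) \<and> 1 \<in> V"

definition multipliers :: "'a set \<Rightarrow> 'a set" where
  "multipliers V = {r. \<forall>x\<in>V. r * x \<in> V}"

lemma multipliers_spanI: "(\<And>i. i \<in> I \<Longrightarrow> y * f i \<in> span I f) \<Longrightarrow> y \<in> multipliers (span I f)"
  unfolding multipliers_def using mult_span_closed[of I y f I f] by blast

lemma finite_moduleI:
  assumes "finite I" "1 \<in> span I f"
  shows "finite_module (span I f)"
proof -
  obtain e where e: "bij_betw e {0..<card I} I"
    using ex_bij_betw_nat_finite[OF assms(1)] by blast
  have "span I f = span {0..<card I} (f \<circ> e)"
  proof (intro equalityI subsetI)
    fix x assume "x \<in> span I f"
    then obtain c where c: "x = (\<Sum>i\<in>I. c i * f i)" "range c \<subseteq> F"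
      unfolding span_def by blast
    have "x = (\<Sum>i\<in>{0..<card I}. (c \<circ> e) i * (f \<circ> e) i)"
      unfolding c(1) using sum.reindex_bij_betw[OF e, of "\<lambda>i. c i * f i"] by simp
    then show "x \<in> span {0..<card I} (f \<circ> e)"
      using c(2) unfolding span_def by (intro CollectI exI[of _ "c \<circ> e"]) auto
  next
    fix x assume x: "x \<in> span {0..<card I} (f \<circ> e)"
    have "1 * (f \<circ> e) i \<in> span I f" if "i \<in> {0..<card I}" for i
      using span_base[OF assms(1) bij_betw_apply[OF e that], of f] by simp
    from mult_span_closed[OF this x] show "x \<in> span I f" by simp
  qed
  then show ?thesis
    using assms(2) unfolding finite_module_def by blast
qed

lemma multiplier_algebraic:
  assumes "finite_module V" "y \<in> multipliers V"
  shows "algebraic_over F y"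
proof -
  obtain I :: "nat set" and f where V: "finite I" "V = span I f" "1 \<in> V"
    using assms(1) unfolding finite_module_def by blast
  have "y ^ n \<in> span I f" for n
    using V assms(2) by (induction n) (auto simp: multipliers_def)
  then obtain c where "range c \<subseteq> F" "\<exists>j\<in>{..card I}. c j \<noteq> 0" "(\<Sum>j\<in>{..card I}. c j * y ^ j) = 0"
    using more_vectors_than_generators_dependent[of I "{..card I}" "\<lambda>j. y ^ j" f] V(1) by auto
  then show ?thesis
    by (intro algebraic_overI[of c "card I"]) auto
qed

lemma multipliers_diff: "finite_module V \<Longrightarrow> r \<in> multipliers V \<Longrightarrow> s \<in> multipliers V \<Longrightarrow> r - s \<in> multipliers V"
  unfolding finite_module_def multipliers_def by (auto simp: algebra_simps intro: span_diff)

lemma multipliers_add: "finite_module V \<Longrightarrow> r \<in> multipliers V \<Longrightarrow> s \<in> multipliers V \<Longrightarrow> r + s \<in> multipliers V"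
  unfolding finite_module_def multipliers_def by (auto simp: algebra_simps intro: span_add)

lemma multipliers_mult: "r \<in> multipliers V \<Longrightarrow> s \<in> multipliers V \<Longrightarrow> r * s \<in> multipliers V"
  unfolding multipliers_def by (auto simp: mult.assoc)

lemma multipliers_base: "finite_module V \<Longrightarrow> F \<subseteq> multipliers V"
  unfolding finite_module_def multipliers_def by (auto intro: span_scale)

lemma finite_module_base_field: "finite_module F"
proof -
  have "span {0::nat} (\<lambda>_. 1) = F"
  proof (intro equalityI subsetI)
    fix x assume "x \<in> F"
    then show "x \<in> span {0::nat} (\<lambda>_. 1)"
      unfolding span_def by (intro CollectI exI[of _ "\<lambda>_. x"]) auto
  qed (auto simp: span_def)
  then show ?thesis
    using finite_moduleI[of "{0::nat}" "\<lambda>_. 1"] one_closed by simp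
qed

text \<open>
  Take the products of the generators of \<open>V\<close> with \<open>1, y, \<dots>, y ^ (n - 1)\<close>; the monic equation brings
  \<open>y ^ n\<close> back into their span.
\<close>
lemma multipliers_adjoin:
  assumes V: "finite_module V"
    and c: "\<And>i. i < n \<Longrightarrow> c i \<in> multipliers V" and y: "y ^ n = (\<Sum>i<n. c i * y ^ i)"
  obtains W where "finite_module W" "insert y (multipliers V) \<subseteq> multipliers W"
proof -
  obtain I :: "nat set" and f where I: "finite I" "V = span I f" "1 \<in> V"
    using V unfolding finite_module_def by blast
  define J where "J = I \<times> {..<n}"
  define g where "g = (\<lambda>(i, k). f i * y ^ k)"
  have J: "finite J" by (simp add: J_def I)
  have V_power: "x * y ^ k \<in> span J g" if "x \<in> V" "k < n" for x k
  proof -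
    have "y ^ k * f i \<in> span J g" if "i \<in> I" for i
      using span_base[OF J, of "(i, k)" g] that \<open>k < n\<close> by (simp add: J_def g_def mult.commute)
    from mult_span_closed[where x = x, OF this] that(1) I(2) show ?thesis
      by (simp add: mult.commute)
  qed
  have fV: "f i \<in> V" if "i \<in> I" for i
    using span_base[OF I(1) that, of f] I(2) by simp
  have "n \<noteq> 0"
    using y by (cases n) auto
  then have "1 \<in> span J g"
    using V_power[OF I(3), of 0] by simp
  moreover have "r \<in> multipliers (span J g)" if r: "r \<in> multipliers V" for r
  proof -
    have "r * g j \<in> span J g" if jJ: "j \<in> J" for j
    proof -
      obtain i k where "j = (i, k)" "i \<in> I" "k < n"
        using jJ by (auto simp: J_def)
      then show ?thesis
        using V_power[of "r * f i" k] r fV[of i] by (simp add: g_def multipliers_def mult.assoc)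
    qed
    then show ?thesis
      by (rule multipliers_spanI)
  qed
  moreover have "y * g j \<in> span J g" if jJ: "j \<in> J" for j
  proof -
    obtain i k where j: "j = (i, k)" "i \<in> I" "k < n"
      using jJ by (auto simp: J_def)
    show ?thesis
    proof (cases "Suc k < n")
      case True
      then show ?thesis
        using span_base[OF J, of "(i, Suc k)" g] j by (simp add: J_def g_def mult_ac)
    next
      case False
      then have n: "n = Suc k" using j by simp
      have "y * g j = f i * y ^ n"
        by (simp add: j g_def n)
      also have "\<dots> = (\<Sum>l<n. (c l * f i) * y ^ l)"
        unfolding y by (simp add: sum_distrib_left mult_ac)
      also have "\<dots> \<in> span J g"
        using c fV[OF j(2)] by (intro span_sum V_power) (auto simp: multipliers_def)
      finally show ?thesis .
    qed
  qed
  then have "y \<in> multipliers (span J g)"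
    by (rule multipliers_spanI)
  ultimately show ?thesis
    using that[OF finite_moduleI[OF J]] by blast
qed

lemma algebraic_common_multipliers:
  assumes "finite S" "\<And>s. s \<in> S \<Longrightarrow> algebraic_over F s"
  obtains V where "finite_module V" "S \<subseteq> multipliers V"
proof -
  have "\<exists>V. finite_module V \<and> S \<subseteq> multipliers V"
    using assms
  proof (induction S rule: finite_induct)
    case empty
    then show ?case using finite_module_base_field by blast
  next
    case (insert y S)
    then obtain V where V: "finite_module V" "S \<subseteq> multipliers V" by auto
    obtain c n where "range c \<subseteq> F" "y ^ n = (\<Sum>i<n. c i * y ^ i)"
      using algebraic_overE[of y] insert.prems by auto
    moreover from this have "c i \<in> multipliers V" for i
      using multipliers_base[OF V(1)] by auto
    ultimately obtain W where "finite_module W" "insert y (multipliers V) \<subseteq> multipliers W"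
      using multipliers_adjoin[OF V(1)] by metis
    then show ?case
      using V(2) by (intro exI[of _ W]) auto
  qed
  then show ?thesis using that by blast
qed

lemma algebraic_add:
  assumes "algebraic_over F x" "algebraic_over F y"
  shows "algebraic_over F (x + y)"
proof -
  obtain V where V: "finite_module V" "{x, y} \<subseteq> multipliers V"
    using algebraic_common_multipliers[of "{x, y}"] assms by auto
  then have "x + y \<in> multipliers V"
    by (simp add: multipliers_add)
  with V(1) show ?thesis
    by (rule multiplier_algebraic)
qed

lemma algebraic_diff:
  assumes "algebraic_over F x" "algebraic_over F y"
  shows "algebraic_over F (x - y)"
proof -
  obtain V where V: "finite_module V" "{x, y} \<subseteq> multipliers V"
    using algebraic_common_multipliers[of "{x, y}"] assms by auto
  then have "x - y \<in> multipliers V"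
    by (simp add: multipliers_diff)
  with V(1) show ?thesis
    by (rule multiplier_algebraic)
qed

lemma algebraic_mult:
  assumes "algebraic_over F x" "algebraic_over F y"
  shows "algebraic_over F (x * y)"
proof -
  obtain V where V: "finite_module V" "{x, y} \<subseteq> multipliers V"
    using algebraic_common_multipliers[of "{x, y}"] assms by auto
  then have "x * y \<in> multipliers V"
    by (simp add: multipliers_mult)
  with V(1) show ?thesis
    by (rule multiplier_algebraic)
qed

lemma algebraic_base: "x \<in> F \<Longrightarrow> algebraic_over F x"
  using multiplier_algebraic[OF finite_module_base_field] multipliers_base[OF finite_module_base_field] by blast

lemma algebraic_uminus: "algebraic_over F x \<Longrightarrow> algebraic_over F (- x)"
  using algebraic_diff[of 0 x] algebraic_base[OF zero_closed] by simp

lemma algebraic_power: "algebraic_over F x \<Longrightarrow> algebraic_over F (x ^ n)"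
  by (induction n) (auto intro: algebraic_mult algebraic_base one_closed)

lemma algebraic_sum: "(\<And>i. i \<in> I \<Longrightarrow> algebraic_over F (f i)) \<Longrightarrow> algebraic_over F (sum f I)"
  by (induction I rule: infinite_finite_induct)
    (auto intro: algebraic_add algebraic_base zero_closed)

lemma algebraic_prod: "(\<And>i. i \<in> I \<Longrightarrow> algebraic_over F (f i)) \<Longrightarrow> algebraic_over F (prod f I)"
  by (induction I rule: infinite_finite_induct)
    (auto intro: algebraic_mult algebraic_base one_closed)

lemma algebraic_of_nat: "algebraic_over F (of_nat n)"
  by (induction n) (auto intro: algebraic_add algebraic_base one_closed zero_closed)

text \<open>
  Transitivity of algebraicity, in the form in which Artin--Schreier equations use it.
\<close>
lemma algebraic_root_of_monic:
  assumes "\<And>i. i < n \<Longrightarrow> algebraic_over F (c i)" "y ^ n = (\<Sum>i<n. c i * y ^ i)"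
  shows "algebraic_over F y"
proof -
  obtain V where V: "finite_module V" "c ` {..<n} \<subseteq> multipliers V"
    using algebraic_common_multipliers[of "c ` {..<n}"] assms(1) by auto
  then obtain W where W: "finite_module W" "insert y (multipliers V) \<subseteq> multipliers W"
    using multipliers_adjoin[OF V(1) _ assms(2)] by (metis image_subset_iff lessThan_iff)
  then show ?thesis
    using multiplier_algebraic[OF W(1)] by blast
qed

end

lemma subfield_field_gen: "subfield_set (field_gen A)"
  by unfold_locales (auto intro: field_gen.intros)

lemma algebraic_over_mono: "algebraic_over F y \<Longrightarrow> F \<subseteq> F' \<Longrightarrow> algebraic_over F' y"
  unfolding algebraic_over_def by blast

section \<open>Derivations in positive characteristic and truncated exponentials\<close>

text \<open>
  Both sides are monic of degree \<open>p - 1\<close> in \<open>x\<close>, and by Fermat's little theorem both vanish at the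
  \<open>p - 1\<close> points \<open>- j\<close>.
\<close>
lemma prod_shifts_eq_power_minus_one:
  fixes x :: "'a::field"
  assumes p: "prime p" "CHAR('a) = p"
  shows "(\<Prod>j=1..<p. x + of_nat j) = x ^ (p - 1) - 1"
proof -
  let ?P = "\<Prod>j=1..<p. [:of_nat j :: 'a, 1:]" and ?Q = "Polynomial.monom (1 :: 'a) (p - 1) - 1"
  let ?A = "(\<lambda>j. - of_nat j :: 'a) ` {1..<p}"
  have p1: "p > 1"
    using p(1) by (rule prime_gt_1_nat)
  have inj: "inj_on (\<lambda>j. - of_nat j :: 'a) {1..<p}"
    using p by (auto intro!: inj_onI simp: of_nat_eq_iff_cong_CHAR cong_def)
  have lead: "lead_coeff ?P = 1"
    by (simp add: lead_coeff_prod)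
  have deg: "degree ?P = p - 1"
    by (subst degree_prod_eq_sum_degree) auto
  have frob: "of_nat j ^ p = (of_nat j :: 'a)" for j
    using freshmans_dream_sum[OF _ p(2)[symmetric], of "\<lambda>_. 1" "{..<j}"] p by simp
  have "?P = ?Q"
  proof (rule poly_eqI_degree_lead_coeff[where n = "p - 1" and A = ?A])
    show "Polynomial.coeff ?P (p - 1) = Polynomial.coeff ?Q (p - 1)"
      using lead deg p1 by simp
    show "p - 1 \<le> card ?A"
      using card_image[OF inj] by simp
    show "degree ?P \<le> p - 1"
      by (simp only: deg)
    show "degree ?Q \<le> p - 1"
      by (rule degree_diff_le) (simp_all add: degree_monom_le)
    show "poly ?P z = poly ?Q z" if "z \<in> ?A" for z
    proof -
      obtain j where j: "z = - of_nat j" "1 \<le> j" "j < p"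
        using \<open>z \<in> ?A\<close> by auto
      have "z ^ p = z"
        using minus_power_prime_CHAR[OF p(2)[symmetric] p(1), of "of_nat j"] frob by (simp add: j)
      then have "z * z ^ (p - 1) = z * 1"
        using p1 by (simp flip: power_Suc)
      moreover have "z \<noteq> 0"
        using j p by (auto simp: of_nat_eq_0_iff_char_dvd dest: dvd_imp_le)
      ultimately have "z ^ (p - 1) = 1"
        by simp
      moreover have "poly ?P z = 0"
        using j by (auto simp: poly_prod intro!: bexI[of _ j])
      ultimately show ?thesis
        by (simp add: poly_monom)
    qed
  qed
  then have "poly ?P x = poly ?Q x" by simp
  then show ?thesis
    by (simp add: poly_prod poly_monom add.commute)
qed

text \<open>
  Divided by \<open>(v + 1) \<cdots> (v + p - 1)\<close>, the sum becomes
  \<open>\<Sum>i<p. (- u) ^ i / ((v + 1) \<cdots> (v + i))\<close>, a deformation of the exponential series of \<open>- u\<close> cut off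
  before its denominators vanish.  Clearing the denominators turns it into a polynomial in \<open>u\<close> and
  \<open>v\<close>, and the sign makes its constant term \<open>1\<close> by Wilson's theorem.
\<close>
definition trunc_exp :: "nat \<Rightarrow> 'a::field \<Rightarrow> 'a \<Rightarrow> 'a" where
  "trunc_exp p u v = - (\<Sum>i<p. (- u) ^ i * (\<Prod>j=Suc i..<p. v + of_nat j))"

text \<open>
  The summand \<open>i = 0\<close> is \<open>v ^ (p - 1) - 1\<close>, and all others are divisible by \<open>u\<close>; so the value
  is congruent to \<open>1\<close> modulo every common divisor of \<open>u\<close> and \<open>v ^ (p - 1)\<close>.
\<close>
lemma trunc_exp_eq:
  fixes u :: "'a::field"
  assumes "prime p" "CHAR('a) = p"
  shows "trunc_exp p u v =
    1 - v ^ (p - 1) + u * (\<Sum>i<p - 1. (- u) ^ i * (\<Prod>j=Suc (Suc i)..<p. v + of_nat j))"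
proof -
  have "p > 0"
    using assms(1) by (rule prime_gt_0_nat)
  then obtain N where N: "p = Suc N"
    by (cases p) auto
  show ?thesis
    using prod_shifts_eq_power_minus_one[OF assms, of v]
    unfolding trunc_exp_def N sum.lessThan_Suc_shift
    by (simp add: sum_distrib_left sum_negf mult.assoc)
qed

locale derivation =
  fixes d :: "'a::field \<Rightarrow> 'a"
  assumes d_add: "d (x + y) = d x + d y"
    and d_mult: "d (x * y) = d x * y + x * d y"
begin

lemma d_0 [simp]: "d 0 = 0"
  using d_add[of 0 0] unfolding add_0 by (metis add_cancel_right_right)

lemma d_1 [simp]: "d 1 = 0"
  using d_mult[of 1 1] unfolding mult_1 mult_1_right by (metis add_cancel_right_right)

lemma d_uminus: "d (- x) = - d x"
  using d_add[of x "- x"] by (simp add: eq_neg_iff_add_eq_0 add.commute)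

lemma d_diff: "d (x - y) = d x - d y"
  using d_add[of x "- y"] by (simp add: d_uminus)

lemma d_sum: "d (sum f I) = (\<Sum>i\<in>I. d (f i))"
  by (induction I rule: infinite_finite_induct) (auto simp: d_add)

lemma d_of_nat [simp]: "d (of_nat n) = 0"
  by (induction n) (auto simp: d_add)

lemma d_power: "d (x ^ n) = of_nat n * x ^ (n - 1) * d x"
proof (induction n)
  case (Suc n)
  then show ?case
    by (cases n) (simp_all add: d_mult algebra_simps)
qed simp

lemma d_power_CHAR: "d (x ^ CHAR('a)) = 0"
  by (simp add: d_power)

lemma d_prod_eq_0: "(\<And>i. i \<in> I \<Longrightarrow> d (f i) = 0) \<Longrightarrow> d (prod f I) = 0"
  by (induction I rule: infinite_finite_induct) (auto simp: d_mult)

lemma d_prod_logarithmic: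
  "(\<And>i. i \<in> I \<Longrightarrow> d (f i) = l i * f i) \<Longrightarrow> d (prod f I) = sum l I * prod f I"
  by (induction I rule: infinite_finite_induct) (auto simp: d_mult algebra_simps)

text \<open>
  With \<open>e\<^sub>i\<close> the \<open>i\<close>-th summand one has \<open>d e\<^sub>i = i w e\<^sub>i\<close> and \<open>(i + v) e\<^sub>i = - u e\<^sub>i\<^sub>-\<^sub>1\<close>.  Hence
  \<open>\<Sum>i<p. (i + u + v) e\<^sub>i\<close> telescopes to \<open>v e\<^sub>0 + u e\<^sub>p\<^sub>-\<^sub>1 = v ^ p - v + u ^ p\<close>, which is zero by the
  Artin--Schreier equation for \<open>v\<close>.
\<close>
lemma d_trunc_exp:
  assumes p: "prime p" "CHAR('a) = p"
    and du: "d u = w * u" and dv: "d v = 0" and v: "v = u ^ p + v ^ p"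
  shows "d (trunc_exp p u v) = - w * (u + v) * trunc_exp p u v"
proof -
  obtain N where N: "p = Suc N"
    using prime_gt_0_nat[OF p(1)] by (cases p) auto
  define e where "e i = (- u) ^ i * (\<Prod>j=Suc i..<p. v + of_nat j)" for i
  have de: "d (e i) = of_nat i * w * e i" for i
  proof -
    have "d (\<Prod>j=Suc i..<p. v + of_nat j) = 0"
      by (rule d_prod_eq_0) (simp add: d_add dv)
    moreover have "d ((- u) ^ i) = of_nat i * w * (- u) ^ i"
      unfolding d_power d_uminus du by (cases i) (simp_all add: algebra_simps)
    ultimately show ?thesis
      by (simp add: e_def d_mult algebra_simps)
  qed
  have step: "(of_nat (Suc i) + v) * e (Suc i) = - u * e i" if "Suc i < p" for i
    using that by (simp add: e_def prod.atLeast_Suc_lessThan[of "Suc i"] algebra_simps)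
  have "e 0 = v ^ (p - 1) - 1"
    using prod_shifts_eq_power_minus_one[OF p, of v] by (simp add: e_def)
  then have "v * e 0 = v ^ p - v"
    by (simp only: right_diff_distrib) (simp add: N)
  moreover have "u * e N = u ^ p"
    using minus_power_prime_CHAR[OF p(2)[symmetric] p(1), of u] N by (simp add: e_def)
  moreover have "(\<Sum>i<p. (of_nat i + v) * e i) = v * e 0 - u * (\<Sum>i<N. e i)"
  proof -
    have "(\<Sum>i<N. (of_nat (Suc i) + v) * e (Suc i)) = (\<Sum>i<N. - u * e i)"
      using step N by (intro sum.cong) auto
    then show ?thesis
      unfolding N sum.lessThan_Suc_shift by (simp add: sum_negf sum_distrib_left)
  qed
  moreover have "(\<Sum>i<p. (of_nat i + v) * e i) = (\<Sum>i<p. of_nat i * e i) + v * (\<Sum>i<p. e i)"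
    by (simp add: distrib_right sum.distrib sum_distrib_left)
  moreover have "(\<Sum>i<p. e i) = (\<Sum>i<N. e i) + e N"
    by (simp add: N)
  ultimately have "(\<Sum>i<p. of_nat i * e i) + (u + v) * (\<Sum>i<p. e i) = u ^ p + v ^ p - v"
    by (simp add: algebra_simps)
  then have *: "(\<Sum>i<p. of_nat i * e i) = - (u + v) * (\<Sum>i<p. e i)"
    unfolding minus_mult_left[symmetric] eq_neg_iff_add_eq_0 by (simp add: v[symmetric])
  have "d (trunc_exp p u v) = - w * (\<Sum>i<p. of_nat i * e i)"
    unfolding trunc_exp_def e_def[symmetric] d_uminus d_sum de by (simp add: sum_distrib_left sum_negf mult_ac)
  then show ?thesis
    unfolding * trunc_exp_def e_def[symmetric] by (simp add: algebra_simps)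
qed

end

lemma CHAR_zrat: "CHAR('p::prime_card zrat) = CARD('p)"
proof (rule CHAR_eqI)
  have eq: "(of_nat n :: 'p zrat) = to_fract (of_nat n)" for n
    by (induction n) auto
  have eq0: "(of_nat n :: 'p zpoly) = 0 \<longleftrightarrow> (of_nat n :: 'p mod_ring) = 0" for n
  proof
    assume "(of_nat n :: 'p zpoly) = 0"
    then have "Poly_Mapping.lookup (of_nat n :: 'p zpoly) 0 = 0" by simp
    then show "(of_nat n :: 'p mod_ring) = 0" by (simp add: lookup_of_nat)
  next
    assume "(of_nat n :: 'p mod_ring) = 0"
    then have "Poly_Mapping.single 0 (of_nat n :: 'p mod_ring) = (0 :: 'p zpoly)" by simp
    then show "(of_nat n :: 'p zpoly) = 0" by (simp only: single_of_nat)
  qed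
  show "of_nat CARD('p) = (0 :: 'p zrat)"
    by (simp add: eq eq0)
  show "CARD('p) dvd n" if "of_nat n = (0 :: 'p zrat)" for n
    using that by (simp add: eq eq0 of_nat_0_mod_ring_dvd)
qed

lemma CHAR_Rp: "CHAR('p::prime_card Rp) = CARD('p)"
  by (simp add: CHAR_zrat)

lemma prime_CARD: "prime CARD('p::prime_card)"
  by (rule prime_card)

interpretation Rp: derivation "Rp_deriv :: 'p::prime_card Rp \<Rightarrow> 'p Rp"
  by unfold_locales (rule Rp_deriv_add Rp_deriv_mult)+

section \<open>Orders, limits and Frobenius on Laurent series\<close>

text \<open>
  Orders are bounded by this predicate instead of by \<open>fls_subdegree\<close>, since the latter assigns to
  the zero series the order \<open>0\<close> and not an infinite one.
\<close>
definition ord_ge :: "int \<Rightarrow> 'a::zero fls \<Rightarrow> bool" where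
  "ord_ge n f \<longleftrightarrow> (\<forall>k<n. f $$ k = 0)"

lemma ord_ge_0 [simp]: "ord_ge n 0"
  by (simp add: ord_ge_def)

lemma ord_ge_mono: "ord_ge n f \<Longrightarrow> m \<le> n \<Longrightarrow> ord_ge m f"
  by (simp add: ord_ge_def)

lemma ord_ge_iff_subdegree: "ord_ge n f \<longleftrightarrow> f = 0 \<or> n \<le> fls_subdegree f"
  using fls_subdegree_geI[of f n] by (auto simp: ord_ge_def)

lemma ord_ge_add: "ord_ge n f \<Longrightarrow> ord_ge n g \<Longrightarrow> ord_ge n (f + g :: 'a::group_add fls)"
  by (simp add: ord_ge_def)

lemma ord_ge_diff: "ord_ge n f \<Longrightarrow> ord_ge n g \<Longrightarrow> ord_ge n (f - g :: 'a::group_add fls)"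
  by (simp add: ord_ge_def)

lemma ord_ge_diff_commute: "ord_ge n (f - g :: 'a::ab_group_add fls) \<longleftrightarrow> ord_ge n (g - f)"
  by (auto simp: ord_ge_def)

lemma ord_ge_diff_trans:
  "ord_ge n (f - g :: 'a::ab_group_add fls) \<Longrightarrow> ord_ge n (g - h) \<Longrightarrow> ord_ge n (f - h)"
  by (simp add: ord_ge_def)

lemma ord_ge_mult:
  assumes "ord_ge m f" "ord_ge n (g :: 'a::comm_ring_1 fls)"
  shows "ord_ge (m + n) (f * g)"
proof (cases "f = 0 \<or> g = 0")
  case False
  then have "m + n \<le> fls_subdegree f + fls_subdegree g"
    using assms by (auto simp: ord_ge_iff_subdegree)
  then show ?thesis
    unfolding ord_ge_def by (auto intro: fls_times_nth_eq0)
qed auto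

lemma ord_ge_mult_le: "ord_ge m f \<Longrightarrow> ord_ge n g \<Longrightarrow> k \<le> m + n \<Longrightarrow> ord_ge k (f * g :: 'a::comm_ring_1 fls)"
  using ord_ge_mult ord_ge_mono by blast

lemma ord_ge_one: "ord_ge 0 (1 :: 'a::comm_ring_1 fls)"
  by (simp add: ord_ge_def)

lemma ord_ge_power: "ord_ge m f \<Longrightarrow> ord_ge (int n * m) (f ^ n :: 'a::comm_ring_1 fls)"
  by (induction n) (auto intro: ord_ge_one ord_ge_mult_le simp: algebra_simps)

lemma ord_ge_X_power: "ord_ge (int n) (fls_X ^ n :: 'a::comm_ring_1 fls)"
  by (simp add: ord_ge_def)

lemma ord_ge_const: "ord_ge 0 (fls_const c)"
  by (simp add: ord_ge_def)

lemma ord_ge_all_imp_eq_0: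
  assumes "\<And>n. ord_ge (int n) f"
  shows "f = 0"
proof (rule fls_eqI)
  fix k
  show "f $$ k = 0 $$ k"
    using assms[of "nat (k + 1)"] by (simp add: ord_ge_def)
qed

lemma dist_fls_le_iff: "dist f g \<le> inverse (2 ^ n) \<longleftrightarrow> ord_ge (int n) (f - g :: 'a::ab_group_add fls)"
proof (cases "f = g \<or> fls_subdegree (f - g) \<ge> 0")
  case True
  then show ?thesis
    by (auto simp: dist_fls_def ord_ge_iff_subdegree power_increasing_iff le_nat_iff)
next
  case False
  then have "dist f g > 1"
    by (auto simp: dist_fls_def)
  moreover have "inverse (2 ^ n) \<le> (1 :: real)"
    by (simp add: inverse_le_1_iff)
  ultimately show ?thesis
    using False by (auto simp: ord_ge_iff_subdegree)
qed

lemma inverse_two_power_small: "e > 0 \<Longrightarrow> \<exists>n. inverse (2 ^ n) < (e :: real)"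
  using real_arch_pow_inv[of e "1/2"] by (auto simp: power_divide inverse_eq_divide)

lemma fls_tendstoI:
  fixes l :: "'a::ab_group_add fls"
  assumes "\<And>n. ord_ge (int n) (l - f n)"
  shows "f \<longlonglongrightarrow> l"
proof (rule metric_LIMSEQ_I)
  fix r :: real assume "0 < r"
  then obtain N where N: "inverse (2 ^ N) < r"
    using inverse_two_power_small by blast
  have "dist (f n) l < r" if "n \<ge> N" for n
  proof -
    have "ord_ge (int N) (f n - l)"
      using assms[of n] that by (auto simp: ord_ge_diff_commute[of _ "f n"] intro: ord_ge_mono)
    then show ?thesis
      using N by (simp flip: dist_fls_le_iff)
  qed
  then show "\<exists>no. \<forall>n\<ge>no. dist (f n) l < r" by blast
qed

lemma closure_fls_iff:
  fixes S :: "'a::ab_group_add fls set"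
  shows "f \<in> closure S \<longleftrightarrow> (\<forall>n. \<exists>g\<in>S. ord_ge (int n) (f - g))"
proof
  assume f: "f \<in> closure S"
  show "\<forall>n. \<exists>g\<in>S. ord_ge (int n) (f - g)"
  proof
    fix n
    obtain g where "g \<in> S" "dist g f < inverse (2 ^ n)"
      using f unfolding closure_approachable by (metis inverse_positive_iff_positive zero_less_numeral zero_less_power)
    then show "\<exists>g\<in>S. ord_ge (int n) (f - g)"
      by (intro bexI[of _ g]) (auto simp: dist_fls_sym[of f] simp flip: dist_fls_le_iff)
  qed
next
  assume *: "\<forall>n. \<exists>g\<in>S. ord_ge (int n) (f - g)"
  show "f \<in> closure S"
    unfolding closure_approachable
  proof (intro allI impI)
    fix e :: real assume "0 < e"
    then obtain N where N: "inverse (2 ^ N) < e"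
      using inverse_two_power_small by blast
    obtain g where "g \<in> S" "ord_ge (int N) (f - g)"
      using * by blast
    then show "\<exists>g\<in>S. dist g f < e"
      using N by (intro bexI[of _ g]) (auto simp: dist_fls_sym[of g] simp flip: dist_fls_le_iff)
  qed
qed

text \<open>
  Completeness in the form needed for recursively defined sequences: the \<open>k\<close>-th coefficient no
  longer changes after step \<open>k + 1\<close>.
\<close>
lemma fls_limit_exists:
  fixes f :: "nat \<Rightarrow> 'a::ab_group_add fls"
  assumes "\<And>n. ord_ge 0 (f n)" and step: "\<And>n. ord_ge (int n) (f (Suc n) - f n)"
  obtains l where "\<And>n. ord_ge (int n) (l - f n)"
proof -
  define l where "l = Abs_fls (\<lambda>k. if k < 0 then 0 else f (Suc (nat k)) $$ k)"
  have l: "l $$ k = (if k < 0 then 0 else f (Suc (nat k)) $$ k)" for k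
    unfolding l_def by (rule nth_Abs_fls_lower_bound[of 0]) simp
  have mono: "ord_ge (int n) (f (n + m) - f n)" for n m
  proof (induction m)
    case (Suc m)
    have "ord_ge (int n) (f (n + Suc m) - f (n + m))"
      using step[of "n + m"] by (auto intro: ord_ge_mono)
    then show ?case
      using Suc ord_ge_diff_trans by blast
  qed simp
  have "ord_ge (int n) (l - f n)" for n
    unfolding ord_ge_def
  proof (intro allI impI)
    fix k assume k: "k < int n"
    show "(l - f n) $$ k = 0"
    proof (cases "k < 0")
      case True
      then show ?thesis
        using assms(1)[of n] by (simp add: l ord_ge_def)
    next
      case False
      then have "Suc (nat k) + (n - Suc (nat k)) = n"
        using k by linarith
      then have "ord_ge (int (Suc (nat k))) (f n - f (Suc (nat k)))"
        using mono[of "Suc (nat k)" "n - Suc (nat k)"] by simp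
      then have "(f n - f (Suc (nat k))) $$ k = 0"
        using False unfolding ord_ge_def by auto
      then show ?thesis
        using False by (simp add: l)
    qed
  qed
  then show ?thesis using that by blast
qed

text \<open>
  Since Frobenius is additive, the leading term can be split off; after finitely many such steps
  the order of the \<open>p\<close>-th power of the rest exceeds \<open>m\<close>.
\<close>
lemma frobenius_nth:
  fixes f :: "'a::field fls"
  assumes p: "prime p" "CHAR('a) = p"
  shows "(f ^ p) $$ m = (if int p dvd m then (f $$ (m div int p)) ^ p else 0)"
proof -
  have p0: "p > 0"
    using p(1) by (rule prime_gt_0_nat)
  have p': "CHAR('a fls) = p"
    using p(2) by simp
  have *: "(f ^ p) $$ m = (if int p dvd m then (f $$ (m div int p)) ^ p else 0)"
    if "ord_ge a f" "m < int p * (a + int N)" for f :: "'a fls" and a m N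
    using that
  proof (induction N arbitrary: a f)
    case 0
    have "m div int p < a"
    proof (rule ccontr)
      assume "\<not> m div int p < a"
      then have "int p * a \<le> int p * (m div int p)"
        by (intro mult_left_mono) auto
      also have "\<dots> \<le> m"
        using p0 by (simp add: minus_mod_eq_mult_div[symmetric])
      finally show False using 0 by simp
    qed
    then have "f $$ (m div int p) = 0"
      using 0 by (simp add: ord_ge_def)
    moreover have "(f ^ p) $$ m = 0"
      using ord_ge_power[OF 0(1), of p] 0(2) by (simp add: ord_ge_def)
    ultimately show ?case
      using p0 by (simp add: power_0_left)
  next
    case (Suc N)
    define s where "s = fls_shift (- a) (fls_const (f $$ a))"
    define r where "r = f - s"
    have r: "ord_ge (a + 1) r"
      using Suc.prems(1) by (auto simp: ord_ge_def r_def s_def)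
    have "f ^ p = s ^ p + r ^ p"
      using freshmans_dream[OF _ p'[symmetric], of s r] p p' by (simp add: r_def)
    moreover have "s ^ p = fls_shift (int p * - a) (fls_const ((f $$ a) ^ p))"
      by (simp add: s_def fls_shifted_pow fls_const_power)
    moreover have "(r ^ p) $$ m = (if int p dvd m then (r $$ (m div int p)) ^ p else 0)"
      using Suc.IH[OF r] Suc.prems(2) by (simp add: algebra_simps)
    moreover have "m = int p * a \<longleftrightarrow> int p dvd m \<and> m div int p = a"
      using p0 by auto
    ultimately show ?case
      using p0 by (auto simp: r_def s_def power_0_left)
  qed
  have "ord_ge (fls_subdegree f) f"
    by (simp add: ord_ge_iff_subdegree)
  moreover have "m < int p * (fls_subdegree f + int (nat (\<bar>m\<bar> + 1 + \<bar>fls_subdegree f\<bar>)))"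
  proof -
    have "m < \<bar>m\<bar> + 1" by simp
    also have "\<dots> \<le> int p * (\<bar>m\<bar> + 1)"
      using mult_right_mono[of 1 "int p" "\<bar>m\<bar> + 1"] p0 by simp
    also have "\<dots> \<le> int p * (fls_subdegree f + int (nat (\<bar>m\<bar> + 1 + \<bar>fls_subdegree f\<bar>)))"
      by (intro mult_left_mono) auto
    finally show ?thesis .
  qed
  ultimately show ?thesis by (rule *)
qed

lemma Rp_deriv_nth: "Rp_deriv f $$ n = of_int (n + 1) * f $$ (n + 1) + delta (f $$ (n + 1))"
proof -
  have "(fls_X_inv * map_coeffs delta f) $$ n = map_coeffs delta f $$ (n + 1)"
    by (simp add: fls_X_inv_times_conv_shift)
  then show ?thesis
    by (simp add: Rp_deriv_def map_coeffs_nth)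
qed

lemma ord_ge_Rp_deriv: "ord_ge n f \<Longrightarrow> ord_ge (n - 1) (Rp_deriv f)"
  by (simp add: ord_ge_def Rp_deriv_nth)

section \<open>Decomposition of algebraic series along \<open>p\<close>-th powers\<close>

text \<open>
  The series \<open>fls_X ^ j * f j ^ p\<close> lives on the exponents congruent to \<open>j\<close> modulo \<open>p\<close>, so only
  \<open>j = i\<close> contributes to the exponent \<open>p * n + i\<close>.
\<close>
lemma p_decomposition_nth:
  fixes f :: "nat \<Rightarrow> 'a::field fls"
  assumes p: "prime p" "CHAR('a) = p" and i: "i < p"
  shows "(\<Sum>j<p. fls_X ^ j * f j ^ p) $$ (int p * n + int i) = (f i $$ n) ^ p"
proof -
  have p0: "p > 0"
    using p(1) by (rule prime_gt_0_nat)
  have *: "(fls_X ^ j * f j ^ p) $$ (int p * n + int i) = (if j = i then (f i $$ n) ^ p else 0)"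
    if "j < p" for j
  proof (cases "j = i")
    case True
    then show ?thesis
      using p0 by (simp add: fls_X_power_times_conv_shift frobenius_nth[OF p])
  next
    case False
    have "\<not> int p dvd int p * n + int i - int j"
    proof
      assume "int p dvd int p * n + int i - int j"
      then have "int p dvd int i - int j"
        by (metis add_diff_eq dvd_add_times_triv_left_iff mult.commute)
      then have "int i mod int p = int j mod int p"
        by (simp add: mod_eq_dvd_iff)
      then show False
        using False i that by simp
    qed
    then show ?thesis
      using False by (simp add: fls_X_power_times_conv_shift frobenius_nth[OF p])
  qed
  have "(\<Sum>j<p. fls_X ^ j * f j ^ p) $$ (int p * n + int i)
      = (\<Sum>j<p. if j = i then (f i $$ n) ^ p else 0)"
    unfolding fls_nth_sum by (rule sum.cong) (use * in auto)
  then show ?thesis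
    using i by simp
qed

lemma p_decomposition_unique:
  fixes f :: "nat \<Rightarrow> 'a::field fls"
  assumes "prime p" "CHAR('a) = p" "(\<Sum>j<p. fls_X ^ j * f j ^ p) = 0" "i < p"
  shows "f i = 0"
proof (rule fls_eqI)
  fix n
  show "f i $$ n = 0 $$ n"
    using p_decomposition_nth[OF assms(1,2,4), of f n] assms(3) by simp
qed

locale subfield_with_X = subfield_set F for F :: "'a::field fls set" +
  fixes p :: nat
  assumes prime: "prime p" and CHAR: "CHAR('a) = p" and X_closed: "fls_X \<in> F"
begin

lemma CHAR_fls: "CHAR('a fls) = p"
  using CHAR by simp

lemma frobenius_sum: "(sum f I :: 'a fls) ^ p = (\<Sum>i\<in>I. f i ^ p)"
  by (rule freshmans_dream_sum) (simp_all add: prime CHAR)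

definition p_decomposable :: "'a fls set" where
  "p_decomposable = {\<Sum>j<p. fls_X ^ j * s j ^ p | s. range s \<subseteq> F}"

lemma p_decomposable_diff:
  assumes "x \<in> p_decomposable" "y \<in> p_decomposable"
  shows "x - y \<in> p_decomposable"
proof -
  obtain s t where "x = (\<Sum>j<p. fls_X ^ j * s j ^ p)" "range s \<subseteq> F"
      "y = (\<Sum>j<p. fls_X ^ j * t j ^ p)" "range t \<subseteq> F"
    using assms unfolding p_decomposable_def by blast
  moreover have "(u - v) ^ p = u ^ p - v ^ p" for u v :: "'a fls"
    using prime CHAR_fls freshmans_dream[OF _ CHAR_fls[symmetric], of u "- v"]
      minus_power_prime_CHAR[OF CHAR_fls[symmetric] prime, of v] by simp
  ultimately show ?thesis
    unfolding p_decomposable_def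
    by (intro CollectI exI[of _ "\<lambda>j. s j - t j"])
      (auto simp: right_diff_distrib sum_subtractf intro!: diff_closed)
qed

lemma p_decomposable_zero: "0 \<in> p_decomposable"
  unfolding p_decomposable_def using prime_gt_0_nat[OF prime]
  by (intro CollectI exI[of _ "\<lambda>_. 0"]) (auto simp: zero_closed power_0_left)

lemma p_decomposable_add: "x \<in> p_decomposable \<Longrightarrow> y \<in> p_decomposable \<Longrightarrow> x + y \<in> p_decomposable"
  using p_decomposable_diff[of x "0 - y"] p_decomposable_diff[OF p_decomposable_zero, of y] by simp

lemma p_decomposable_sum: "(\<And>i. i \<in> I \<Longrightarrow> f i \<in> p_decomposable) \<Longrightarrow> sum f I \<in> p_decomposable"
  by (induction I rule: infinite_finite_induct) (auto intro: p_decomposable_zero p_decomposable_add)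

lemma p_decomposable_monomial:
  assumes s: "s \<in> F"
  shows "fls_X ^ m * s ^ p \<in> p_decomposable"
proof -
  let ?t = "\<lambda>j. if j = m mod p then fls_X ^ (m div p) * s else 0"
  have p0: "p > 0"
    using prime by (rule prime_gt_0_nat)
  have "fls_X ^ m * s ^ p = fls_X ^ (m mod p) * (fls_X ^ (m div p) * s) ^ p"
    by (simp add: power_mult_distrib flip: power_mult power_add mult.assoc)
  also have "\<dots> = (\<Sum>j<p. if j = m mod p then fls_X ^ j * (fls_X ^ (m div p) * s) ^ p else 0)"
    using p0 by simp
  also have "\<dots> = (\<Sum>j<p. fls_X ^ j * ?t j ^ p)"
    using p0 by (intro sum.cong) (auto simp: power_0_left)
  finally show ?thesis
    unfolding p_decomposable_def using s
    by (intro CollectI exI[of _ ?t]) (auto intro!: mult_closed power_closed X_closed zero_closed)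
qed

lemma p_decomposable_mult:
  assumes "x \<in> p_decomposable" "y \<in> p_decomposable"
  shows "x * y \<in> p_decomposable"
proof -
  obtain s t where st: "x = (\<Sum>j<p. fls_X ^ j * s j ^ p)" "range s \<subseteq> F"
      "y = (\<Sum>j<p. fls_X ^ j * t j ^ p)" "range t \<subseteq> F"
    using assms unfolding p_decomposable_def by blast
  have "x * y = (\<Sum>i<p. \<Sum>j<p. fls_X ^ (i + j) * (s i * t j) ^ p)"
    unfolding st(1,3) sum_product by (simp add: power_add power_mult_distrib mult_ac)
  also have "\<dots> \<in> p_decomposable"
    using st by (intro p_decomposable_sum p_decomposable_monomial mult_closed) auto
  finally show ?thesis .
qed

lemma p_decomposable_inverse:
  assumes "x \<in> F" "x \<in> p_decomposable"
  shows "inverse x \<in> p_decomposable"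
proof -
  obtain N where N: "p = Suc N"
    using prime_gt_0_nat[OF prime] by (cases p) auto
  have one: "1 \<in> p_decomposable"
    using p_decomposable_monomial[OF one_closed, of 0] by simp
  have "x ^ n \<in> p_decomposable" for n
    by (induction n) (auto intro: one assms p_decomposable_mult)
  \<comment> \<open>\<open>1 / x = x ^ (p - 1) * (1 / x) ^ p\<close>, where \<open>(1 / x) ^ p\<close> is decomposed by a single term\<close>
  then have "x ^ N * (fls_X ^ 0 * inverse x ^ p) \<in> p_decomposable"
    by (intro p_decomposable_mult p_decomposable_monomial inverse_closed assms)
  also have "x ^ N * (fls_X ^ 0 * inverse x ^ p) = inverse x"
    by (cases "x = 0") (simp_all add: N power_inverse)
  finally show ?thesis .
qed

text \<open>
  This plays the part of the separability of \<open>F(a)\<close> over \<open>F\<close>.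
  A linear relation between the powers of \<open>a ^ p\<close> with \<open>p\<close>-decomposable coefficients splits into
  \<open>p\<close> relations between the powers of \<open>a\<close>, so linear independence is inherited by the \<open>p\<close>-th
  powers.  By counting dimensions, \<open>a\<close> is then a combination of powers of \<open>a ^ p\<close>, and decomposing
  its coefficients decomposes \<open>a\<close>.
\<close>
lemma algebraic_p_decomposition:
  assumes F: "F \<subseteq> p_decomposable" and a: "algebraic_over F a"
  obtains \<alpha> where "\<And>i. algebraic_over F (\<alpha> i)" "a = (\<Sum>j<p. fls_X ^ j * \<alpha> j ^ p)"
proof -
  define rel where "rel d \<longleftrightarrow> (\<exists>c. range c \<subseteq> F \<and> (\<exists>i<d. c i \<noteq> 0) \<and> (\<Sum>i<d. c i * a ^ i) = 0)" for d
  obtain P where P: "P \<noteq> 0" "\<And>i. Polynomial.coeff P i \<in> F" "poly P a = 0"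
    using a unfolding algebraic_over_def by blast
  have "rel (Suc (degree P))"
    unfolding rel_def using P
    by (intro exI[of _ "Polynomial.coeff P"] conjI exI[of _ "degree P"])
      (auto simp: poly_altdef lessThan_Suc_atMost)
  then obtain D where D: "rel D" "\<And>e. e < D \<Longrightarrow> \<not> rel e"
    using exists_least_iff[of rel] by blast
  then obtain d where d: "D = Suc d"
    unfolding rel_def by (cases D) auto
  have indep: "c i = 0" if "range c \<subseteq> F" "(\<Sum>i<d. c i * a ^ i) = 0" "i < d" for c i
    using D(2)[of d] that unfolding rel_def d by blast
  obtain c where c: "range c \<subseteq> F" "\<exists>i<Suc d. c i \<noteq> 0" "(\<Sum>i<Suc d. c i * a ^ i) = 0"
    using D(1) unfolding rel_def d by blast
  have "c d \<noteq> 0"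
  proof
    assume "c d = 0"
    then have "(\<Sum>i<d. c i * a ^ i) = 0" using c(3) by simp
    then have "c i = 0" if "i < d" for i using indep[OF c(1)] that by blast
    with c(2) \<open>c d = 0\<close> show False by (auto simp: less_Suc_eq)
  qed
  have ad: "a ^ d \<in> span {..<d} (\<lambda>i. a ^ i)"
  proof -
    have "c d * a ^ d = - (\<Sum>i<d. c i * a ^ i)"
      using c(3) by (simp add: eq_neg_iff_add_eq_0 add.commute)
    then have "a ^ d = - (\<Sum>i<d. c i * a ^ i) / c d"
      using \<open>c d \<noteq> 0\<close> by (simp add: field_simps)
    also have "\<dots> = (\<Sum>i<d. (- c i / c d) * a ^ i)"
      by (simp add: sum_divide_distrib sum_negf)
    finally show ?thesis
      unfolding span_def using c(1)
      by (intro CollectI exI[of _ "\<lambda>i. - c i / c d"]) (auto intro!: divide_closed uminus_closed)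
  qed
  have d0: "d > 0"
    using \<open>c d \<noteq> 0\<close> c(3) by (cases d) auto
  have powers: "a ^ n \<in> span {..<d} (\<lambda>i. a ^ i)" for n
  proof (induction n)
    case 0
    then show ?case using span_base[of "{..<d}" 0 "\<lambda>i. a ^ i"] d0 by simp
  next
    case (Suc n)
    have "a * a ^ i \<in> span {..<d} (\<lambda>i. a ^ i)" if "i < d" for i
      using span_base[of "{..<d}" "Suc i" "\<lambda>i. a ^ i"] ad that by (cases "Suc i = d") auto
    then show ?case
      using mult_span_closed[of "{..<d}" a "\<lambda>i. a ^ i" "{..<d}" "\<lambda>i. a ^ i", OF _ Suc] by simp
  qed
  have split: "\<exists>s. (\<forall>i j. s i j \<in> F) \<and> (\<forall>i. e i = (\<Sum>j<p. fls_X ^ j * s i j ^ p)) \<and>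
      (\<Sum>i<d. e i * (a ^ i) ^ p) = (\<Sum>j<p. fls_X ^ j * (\<Sum>i<d. s i j * a ^ i) ^ p)"
    if "range e \<subseteq> F" for e
  proof -
    have "\<forall>i. \<exists>s. range s \<subseteq> F \<and> e i = (\<Sum>j<p. fls_X ^ j * s j ^ p)"
      using that F unfolding p_decomposable_def by blast
    then obtain s where s: "\<And>i. range (s i) \<subseteq> F" "\<And>i. e i = (\<Sum>j<p. fls_X ^ j * s i j ^ p)"
      by metis
    have "(\<Sum>i<d. e i * (a ^ i) ^ p) = (\<Sum>i<d. \<Sum>j<p. fls_X ^ j * (s i j * a ^ i) ^ p)"
      by (simp add: s(2) sum_distrib_left sum_distrib_right power_mult_distrib mult_ac)
    also have "\<dots> = (\<Sum>j<p. \<Sum>i<d. fls_X ^ j * (s i j * a ^ i) ^ p)"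
      by (rule sum.swap)
    also have "\<dots> = (\<Sum>j<p. fls_X ^ j * (\<Sum>i<d. s i j * a ^ i) ^ p)"
      by (simp add: frobenius_sum sum_distrib_left)
    finally show ?thesis
      using s by blast
  qed
  have indep_p: "e i = 0" if e: "range e \<subseteq> F" "(\<Sum>i<d. e i * (a ^ i) ^ p) = 0" "i < d" for e i
  proof -
    obtain s where s: "\<And>i j. s i j \<in> F" "\<And>i. e i = (\<Sum>j<p. fls_X ^ j * s i j ^ p)"
        "(\<Sum>i<d. e i * (a ^ i) ^ p) = (\<Sum>j<p. fls_X ^ j * (\<Sum>i<d. s i j * a ^ i) ^ p)"
      using split[OF e(1)] by blast
    have "(\<Sum>i<d. s i j * a ^ i) = 0" if "j < p" for j
      using p_decomposition_unique[OF prime CHAR, of "\<lambda>j. \<Sum>i<d. s i j * a ^ i" j] s(3) e(2) that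
      by simp
    then have "s i j = 0" if "j < p" for j
      using indep[of "\<lambda>i. s i j" i] s(1) e(3) that by auto
    then show ?thesis
      using prime_gt_0_nat[OF prime] by (simp add: s(2) power_0_left)
  qed
  \<comment> \<open>\<open>d + 1\<close> vectors in a space with \<open>d\<close> generators: the \<open>p\<close>-th powers and, in position \<open>d\<close>, \<open>a\<close> itself\<close>
  define g where "g j = (if j < d then (a ^ j) ^ p else a)" for j
  have "g j \<in> span {..<d} (\<lambda>i. a ^ i)" for j
    using powers[of "j * p"] powers[of 1] by (simp add: g_def power_mult)
  then obtain e where e: "range e \<subseteq> F" "\<exists>j\<in>{..d}. e j \<noteq> 0" "(\<Sum>j\<in>{..d}. e j * g j) = 0"
    using more_vectors_than_generators_dependent[of "{..<d}" "{..d}" g "\<lambda>i. a ^ i"] by auto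
  have rel_e: "(\<Sum>j<d. e j * (a ^ j) ^ p) + e d * a = 0"
    using e(3) by (simp add: g_def lessThan_Suc_atMost[symmetric])
  have "e d \<noteq> 0"
  proof
    assume "e d = 0"
    then have "e i = 0" if "i < d" for i
      using indep_p[OF e(1)] rel_e that by simp
    with e(2) \<open>e d = 0\<close> show False by (auto simp: le_less)
  qed
  define e' where "e' i = - e i / e d" for i
  have e': "range e' \<subseteq> F"
    using e(1) by (auto simp: e'_def intro!: divide_closed uminus_closed)
  have "e d * a = - (\<Sum>j<d. e j * (a ^ j) ^ p)"
    using rel_e by (simp add: eq_neg_iff_add_eq_0 add.commute)
  then have "a = - (\<Sum>j<d. e j * (a ^ j) ^ p) / e d"
    using \<open>e d \<noteq> 0\<close> by (simp add: field_simps)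
  then have a_eq: "a = (\<Sum>j<d. e' j * (a ^ j) ^ p)"
    by (simp add: e'_def sum_divide_distrib sum_negf)
  obtain s where s: "\<And>i j. s i j \<in> F"
      "(\<Sum>i<d. e' i * (a ^ i) ^ p) = (\<Sum>j<p. fls_X ^ j * (\<Sum>i<d. s i j * a ^ i) ^ p)"
    using split[OF e'] by blast
  show ?thesis
  proof (rule that[of "\<lambda>j. \<Sum>i<d. s i j * a ^ i"])
    show "algebraic_over F (\<Sum>i<d. s i j * a ^ i)" for j
      by (intro algebraic_sum algebraic_mult algebraic_power a algebraic_base s(1))
    show "a = (\<Sum>j<p. fls_X ^ j * (\<Sum>i<d. s i j * a ^ i) ^ p)"
      using a_eq s(2) by simp
  qed
qed

end

interpretation ratfun: subfield_with_X "ratfun k :: 'p::prime_card Rp set" "CARD('p)" for k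
proof -
  interpret subfield_set "ratfun k :: 'p Rp set"
    unfolding ratfun_def by (rule subfield_field_gen)
  show "subfield_with_X (ratfun k :: 'p Rp set) CARD('p)"
    by unfold_locales (auto simp: prime_CARD CHAR_zrat ratfun_def intro: field_gen.base)
qed

lemma ratfun_0_p_decomposable: "(ratfun 0 :: 'p::prime_card Rp set) \<subseteq> ratfun.p_decomposable 0"
proof
  fix c :: "'p Rp"
  assume "c \<in> ratfun 0"
  then have "c \<in> field_gen {fls_X}"
    by (simp add: ratfun_def)
  then show "c \<in> ratfun.p_decomposable 0"
  proof induction
    case (base a)
    then show ?case
      using ratfun.p_decomposable_monomial[where k = 0 and m = 1, OF ratfun.one_closed] by simp
  next
    case one
    then show ?case
      using ratfun.p_decomposable_monomial[where k = 0 and m = 0, OF ratfun.one_closed] by simp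
  next
    case (inv a)
    then show ?case
      by (intro ratfun.p_decomposable_inverse) (simp_all add: ratfun_def)
  qed (auto intro: ratfun.p_decomposable_diff ratfun.p_decomposable_mult)
qed

lemma ratfun_mono: "k \<le> l \<Longrightarrow> ratfun k \<subseteq> ratfun l"
proof
  fix c :: "'p::prime_card Rp"
  assume kl: "k \<le> l" and "c \<in> ratfun k"
  then have "c \<in> field_gen (insert fls_X (zvar ` {..<k}))"
    by (simp add: ratfun_def)
  then show "c \<in> ratfun l"
    unfolding ratfun_def by induction (use kl in \<open>auto intro: field_gen.intros\<close>)
qed

section \<open>The ring \<open>\<S>\<^sub>p\<close>\<close>

lemma ring_gen_zero: "0 \<in> ring_gen A"
  using ring_gen.diff[OF ring_gen.one ring_gen.one] by simp

lemma ring_gen_uminus: "x \<in> ring_gen A \<Longrightarrow> - x \<in> ring_gen A"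
  using ring_gen.diff[OF ring_gen_zero] by force

lemma ring_gen_add: "x \<in> ring_gen A \<Longrightarrow> y \<in> ring_gen A \<Longrightarrow> x + y \<in> ring_gen A"
  using ring_gen.diff[of x A "- y"] ring_gen_uminus by force

lemma ring_gen_sum: "(\<And>i. i \<in> I \<Longrightarrow> f i \<in> ring_gen A) \<Longrightarrow> sum f I \<in> ring_gen A"
  by (induction I rule: infinite_finite_induct) (auto intro: ring_gen_zero ring_gen_add)

lemma ring_gen_prod: "(\<And>i. i \<in> I \<Longrightarrow> f i \<in> ring_gen A) \<Longrightarrow> prod f I \<in> ring_gen A"
  by (induction I rule: infinite_finite_induct) (auto intro: ring_gen.one ring_gen.mult)

lemma ring_gen_power: "x \<in> ring_gen A \<Longrightarrow> x ^ n \<in> ring_gen A"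
  by (induction n) (auto intro: ring_gen.one ring_gen.mult)

lemma ring_gen_mono: "A \<subseteq> B \<Longrightarrow> ring_gen A \<subseteq> ring_gen B"
proof
  fix x assume "A \<subseteq> B" "x \<in> ring_gen A"
  from this(2,1) show "x \<in> ring_gen B"
    by induction (auto intro: ring_gen.intros)
qed

definition tgen :: "nat \<Rightarrow> 'p::prime_card Rp" where
  "tgen k = fls_X ^ (CARD('p) ^ k) * wmon k"

lemma CARD_prime_ge_2: "CARD('p::prime_card) \<ge> 2"
  using prime_CARD[where 'p = 'p] by (rule prime_ge_2_nat)

lemma tgen_0: "tgen 0 = fls_X"
  by (simp add: tgen_def wmon_def)

lemma tgen_Suc: "tgen (Suc k) = tgen k ^ CARD('p) * (zvar k :: 'p::prime_card Rp)"
proof -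
  have "(\<Prod>j<k. zvar j ^ (CARD('p) ^ (k - j))) = (wmon k :: 'p Rp) ^ CARD('p)"
    unfolding wmon_def prod_power_distrib
  proof (rule prod.cong[OF refl])
    fix j assume "j \<in> {..<k}"
    then have "k - j = Suc (k - 1 - j)" by auto
    then show "zvar j ^ (CARD('p) ^ (k - j)) = ((zvar j :: 'p Rp) ^ (CARD('p) ^ (k - 1 - j))) ^ CARD('p)"
      by (simp add: mult.commute flip: power_mult)
  qed
  then have "wmon (Suc k) = (wmon k :: 'p Rp) ^ CARD('p) * zvar k"
    by (simp add: wmon_def)
  then show ?thesis
    by (simp add: tgen_def power_mult_distrib mult_ac flip: power_mult)
qed

lemma zvar_nonzero: "zvar j \<noteq> (0 :: 'p::prime_card Rp)"
  by (simp add: zvar_def)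

lemma tgen_nonzero: "tgen k \<noteq> (0 :: 'p::prime_card Rp)"
  by (induction k) (auto simp: tgen_0 tgen_Suc zvar_nonzero)

text \<open>
  By \<open>tgen_Suc\<close> and since \<open>p\<close>-th powers are constants, the left-hand side is
  \<open>t\<^sub>k ^ p / (x z\<^sub>1 \<cdots> z\<^sub>k)\<close>; the recursion in turn gives \<open>t\<^sub>k = x z\<^sub>1 \<cdots> z\<^sub>k \<partial>t\<^sub>k\<close>.  Iterating, the derivative of
  \<open>t\<^sub>k\<^sub>+\<^sub>1\<close> is \<open>(t\<^sub>0 \<cdots> t\<^sub>k) ^ (p - 1)\<close>, as for divided powers of \<open>x\<close> of exponents \<open>1, p, p\<^sup>2, \<dots>\<close>
  up to constant factors.
\<close>
lemma deriv_tgen_Suc: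
  "Rp_deriv (tgen (Suc k)) = tgen k ^ (CARD('p) - 1) * Rp_deriv (tgen k :: 'p::prime_card Rp)"
proof -
  let ?Q = "\<lambda>k. fls_X * (\<Prod>i<k. zvar i) :: 'p Rp"
  have Q: "?Q k \<noteq> 0" for k
    by (simp add: zvar_nonzero)
  have d: "Rp_deriv (tgen (Suc k)) = tgen k ^ CARD('p) / ?Q k" for k
    using Rp.d_power_CHAR[of "tgen k :: 'p Rp"]
    by (simp add: tgen_Suc Rp_deriv_mult CHAR_zrat Rp_deriv_zvar divide_inverse)
  have "tgen k = ?Q k * Rp_deriv (tgen k)"
  proof (cases k)
    case 0
    then show ?thesis by (simp add: tgen_0 Rp_deriv_X)
  next
    case (Suc l)
    have "?Q k * Rp_deriv (tgen k) = zvar l * (?Q l * (tgen l ^ CARD('p) / ?Q l))"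
      by (simp add: Suc d mult_ac)
    also have "\<dots> = tgen k"
      using Q[of l] by (simp add: Suc tgen_Suc)
    finally show ?thesis ..
  qed
  moreover have "(tgen k :: 'p Rp) ^ CARD('p) = tgen k ^ (CARD('p) - 1) * tgen k"
    using CARD_prime_ge_2[where 'p = 'p] by (simp flip: power_Suc2)
  ultimately show ?thesis
    using Q[of k] by (simp add: d field_simps)
qed

lemma ord_ge_tgen: "ord_ge (int (CARD('p) ^ k)) (tgen k :: 'p::prime_card Rp)"
proof -
  have "(wmon k :: 'p Rp) = fls_const (\<Prod>j<k. zc j ^ (CARD('p) ^ (k - 1 - j)))"
    by (simp add: wmon_def zvar_def fls_const_prod fls_const_power)
  then show ?thesis
    unfolding tgen_def by (intro ord_ge_mult_le[OF ord_ge_X_power, of 0]) (auto intro: ord_ge_const)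
qed

lemma less_CARD_power: "int k < int (CARD('p::prime_card) ^ k)"
  using less_exp[of k] power_mono[OF CARD_prime_ge_2[where 'p = 'p], of k] by linarith

lemma Sp_eq: "Sp = closure (ring_gen (range tgen))"
  by (simp add: Sp_def tgen_def[abs_def])

lemma ring_gen_tgen_ord_ge: "f \<in> ring_gen (range tgen) \<Longrightarrow> ord_ge 0 (f :: 'p::prime_card Rp)"
proof (induction rule: ring_gen.induct)
  case (base f)
  then obtain k where "f = tgen k" by blast
  then show ?case
    using ord_ge_mono[OF ord_ge_tgen[of k, where 'p = 'p], of 0] by simp
next
  case (mult f g)
  then show ?case
    using ord_ge_mult[of 0 f 0 g] by simp
qed (auto intro: ord_ge_one ord_ge_diff)

lemma Sp_ord_ge:
  assumes "f \<in> Sp"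
  shows "ord_ge 0 f"
proof -
  obtain g where "g \<in> ring_gen (range tgen)" "ord_ge (int 0) (f - g)"
    using assms unfolding Sp_eq closure_fls_iff by blast
  then have "ord_ge 0 (f - g + g)"
    using ord_ge_add[OF _ ring_gen_tgen_ord_ge] by fastforce
  then show ?thesis by simp
qed

lemma Sp_base: "f \<in> ring_gen (range tgen) \<Longrightarrow> f \<in> Sp"
  unfolding Sp_eq using closure_subset by blast

lemma Sp_diff:
  assumes "f \<in> Sp" "g \<in> Sp"
  shows "f - g \<in> Sp"
  unfolding Sp_eq closure_fls_iff
proof
  fix n
  obtain f' g' where f': "f' \<in> ring_gen (range tgen)" "ord_ge (int n) (f - f')"
    and g': "g' \<in> ring_gen (range tgen)" "ord_ge (int n) (g - g')"
    using assms unfolding Sp_eq closure_fls_iff by blast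
  have "f - g - (f' - g') = (f - f') - (g - g')"
    by simp
  then show "\<exists>h\<in>ring_gen (range tgen). ord_ge (int n) (f - g - h)"
    using f' g' by (metis ring_gen.diff ord_ge_diff)
qed

lemma Sp_mult:
  assumes "f \<in> Sp" "g \<in> Sp"
  shows "f * g \<in> Sp"
  unfolding Sp_eq closure_fls_iff
proof
  fix n
  obtain f' g' where f': "f' \<in> ring_gen (range tgen)" "ord_ge (int n) (f - f')"
    and g': "g' \<in> ring_gen (range tgen)" "ord_ge (int n) (g - g')"
    using assms unfolding Sp_eq closure_fls_iff by blast
  have "f * g - f' * g' = f * (g - g') + (f - f') * g'"
    by (simp add: algebra_simps)
  moreover have "ord_ge (int n) (f * (g - g'))"
    by (rule ord_ge_mult_le[OF Sp_ord_ge[OF assms(1)] g'(2)]) simp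
  moreover have "ord_ge (int n) ((f - f') * g')"
    by (rule ord_ge_mult_le[OF f'(2) ring_gen_tgen_ord_ge[OF g'(1)]]) simp
  ultimately have "ord_ge (int n) (f * g - f' * g')"
    by (simp add: ord_ge_add)
  then show "\<exists>h\<in>ring_gen (range tgen). ord_ge (int n) (f * g - h)"
    using ring_gen.mult[OF f'(1) g'(1)] by blast
qed

lemma Sp_limit:
  assumes "\<And>n. f n \<in> Sp" "\<And>n. ord_ge (int n) (l - f n)"
  shows "l \<in> Sp"
  unfolding Sp_eq closure_fls_iff
proof
  fix n
  obtain g where "g \<in> ring_gen (range tgen)" "ord_ge (int n) (f n - g)"
    using assms(1)[of n] unfolding Sp_eq closure_fls_iff by blast
  then show "\<exists>g\<in>ring_gen (range tgen). ord_ge (int n) (l - g)"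
    using assms(2)[of n] ord_ge_diff_trans by blast
qed

definition zpol :: "nat \<Rightarrow> 'p::prime_card zrat set" where
  "zpol k = ring_gen (zc ` {..<k})"

text \<open>
  Elements of \<open>\<S>\<^sub>p\<close> with coefficients that are polynomials, and not only rational functions, in
  \<open>z\<^sub>1, \<dots>, z\<^sub>k\<close>: these are the series on which the projections act as ring homomorphisms, and on
  which \<open>\<pi>\<^sub>k\<close> is the identity.
\<close>
definition Sp_poly :: "nat \<Rightarrow> 'p::prime_card Rp set" where
  "Sp_poly k = {f \<in> Sp. \<forall>n. f $$ n \<in> zpol k}"

lemma Sp_poly_diff: "f \<in> Sp_poly k \<Longrightarrow> g \<in> Sp_poly k \<Longrightarrow> f - g \<in> Sp_poly k"
  by (auto simp: Sp_poly_def zpol_def intro: Sp_diff ring_gen.diff)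

lemma Sp_poly_mult: "f \<in> Sp_poly k \<Longrightarrow> g \<in> Sp_poly k \<Longrightarrow> f * g \<in> Sp_poly k"
  by (auto simp: Sp_poly_def zpol_def fls_times_nth(2) intro!: Sp_mult ring_gen_sum ring_gen.mult)

lemma Sp_poly_one: "1 \<in> Sp_poly k"
  by (auto simp: Sp_poly_def zpol_def intro: Sp_base ring_gen.one ring_gen_zero)

lemma Sp_poly_zero: "0 \<in> Sp_poly k"
  using Sp_poly_diff[OF Sp_poly_one Sp_poly_one] by simp

lemma Sp_poly_uminus: "f \<in> Sp_poly k \<Longrightarrow> - f \<in> Sp_poly k"
  using Sp_poly_diff[OF Sp_poly_zero] by force

lemma Sp_poly_add: "f \<in> Sp_poly k \<Longrightarrow> g \<in> Sp_poly k \<Longrightarrow> f + g \<in> Sp_poly k"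
  using Sp_poly_diff[of f k "- g"] Sp_poly_uminus by force

lemma Sp_poly_sum: "(\<And>i. i \<in> I \<Longrightarrow> f i \<in> Sp_poly k) \<Longrightarrow> sum f I \<in> Sp_poly k"
  by (induction I rule: infinite_finite_induct) (auto intro: Sp_poly_zero Sp_poly_add)

lemma Sp_poly_prod: "(\<And>i. i \<in> I \<Longrightarrow> f i \<in> Sp_poly k) \<Longrightarrow> prod f I \<in> Sp_poly k"
  by (induction I rule: infinite_finite_induct) (auto intro: Sp_poly_one Sp_poly_mult)

lemma Sp_poly_power: "f \<in> Sp_poly k \<Longrightarrow> f ^ n \<in> Sp_poly k"
  by (induction n) (auto intro: Sp_poly_one Sp_poly_mult)

lemma Sp_poly_of_nat: "of_nat n \<in> Sp_poly k"
  by (induction n) (auto intro: Sp_poly_zero Sp_poly_one Sp_poly_add)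

lemmas Sp_poly_intros = Sp_poly_diff Sp_poly_mult Sp_poly_one Sp_poly_zero Sp_poly_uminus
  Sp_poly_add Sp_poly_sum Sp_poly_prod Sp_poly_power Sp_poly_of_nat

lemma Sp_poly_ord_ge: "f \<in> Sp_poly k \<Longrightarrow> ord_ge 0 f"
  by (auto simp: Sp_poly_def intro: Sp_ord_ge)

lemma Sp_poly_mono: "k \<le> l \<Longrightarrow> Sp_poly k \<subseteq> Sp_poly l"
  using ring_gen_mono[of "zc ` {..<k}" "zc ` {..<l}"] by (fastforce simp: Sp_poly_def zpol_def)

lemma Sp_poly_subset: "Sp_poly k \<subseteq> Sp_upto k"
proof -
  have "c \<in> field_gen A" if "c \<in> ring_gen A" for c :: "'p::prime_card zrat" and A
    using that by induction (auto intro: field_gen.intros)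
  then show ?thesis
    by (auto simp: Sp_poly_def Sp_upto_def Rp_upto_def zrat_upto_def zpol_def)
qed

lemma Sp_poly_limit:
  assumes "\<And>n. f n \<in> Sp_poly k" "\<And>n. ord_ge (int n) (l - f n)"
  shows "l \<in> Sp_poly k"
proof -
  have "l \<in> Sp"
  proof (rule Sp_limit)
    show "f n \<in> Sp" for n
      using assms(1)[of n] by (simp add: Sp_poly_def)
  qed (rule assms(2))
  moreover have "l $$ n \<in> zpol k" for n
  proof -
    have "l $$ n = f (nat (n + 1)) $$ n"
      using assms(2)[of "nat (n + 1)"] by (auto simp: ord_ge_def)
    then show ?thesis
      using assms(1)[of "nat (n + 1)"] by (simp add: Sp_poly_def)
  qed
  ultimately show ?thesis
    by (simp add: Sp_poly_def)
qed

lemma tgen_in_Sp_poly: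
  assumes "k \<le> l"
  shows "(tgen k :: 'p::prime_card Rp) \<in> Sp_poly l"
proof -
  have w: "(wmon k :: 'p Rp) = fls_const (\<Prod>j<k. zc j ^ (CARD('p) ^ (k - 1 - j)))" (is "_ = fls_const ?c")
    by (simp add: wmon_def zvar_def fls_const_prod fls_const_power)
  have "?c \<in> zpol l"
    using assms unfolding zpol_def
    by (intro ring_gen_prod ring_gen_power ring_gen.base) auto
  then have "(tgen k :: 'p Rp) $$ n \<in> zpol l" for n
    by (auto simp: tgen_def w fls_X_power_times_conv_shift zpol_def intro: ring_gen_zero)
  moreover have "tgen k \<in> (Sp :: 'p Rp set)"
    by (intro Sp_base ring_gen.base) auto
  ultimately show ?thesis
    by (simp add: Sp_poly_def)
qed

lemma tgen_in_ratfun: "(tgen k :: 'p::prime_card Rp) \<in> ratfun k"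
proof (induction k)
  case 0
  show ?case by (simp add: tgen_0 ratfun.X_closed)
next
  case (Suc k)
  have "(tgen k :: 'p Rp) \<in> ratfun (Suc k)"
    using Suc ratfun_mono[of k "Suc k"] by auto
  moreover have "(zvar k :: 'p Rp) \<in> ratfun (Suc k)"
    unfolding ratfun_def by (intro field_gen.base) auto
  ultimately show ?case
    unfolding tgen_Suc by (intro ratfun.mult_closed ratfun.power_closed)
qed

text \<open>
  The polynomial \<open>c ^ p - c\<close> is the product of the \<open>c + j\<close> for \<open>j < p\<close>.
\<close>
lemma frobenius_fixed_is_of_nat:
  assumes "c ^ CARD('p) = (c :: 'p::prime_card zrat)"
  shows "\<exists>j. c = - of_nat j"
proof -
  have "c * (c ^ (CARD('p) - 1) - 1) = c ^ CARD('p) - c"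
    using CARD_prime_ge_2[where 'p = 'p] by (simp add: right_diff_distrib flip: power_Suc)
  then have "c * (\<Prod>j=1..<CARD('p). c + of_nat j) = 0"
    using prod_shifts_eq_power_minus_one[OF prime_CARD CHAR_zrat, of c] assms by simp
  then have "c = 0 \<or> (\<exists>j. c + of_nat j = 0)"
    by auto
  then show ?thesis
    by (metis of_nat_0 minus_zero eq_neg_iff_add_eq_0)
qed

text \<open>
  The truncations of such a series are polynomials in \<open>x = t\<^sub>0\<close> over the prime field.
\<close>
lemma prime_field_series_in_Sp_poly:
  fixes f :: "'p::prime_card Rp"
  assumes "ord_ge 0 f" "\<And>n. (f $$ n) ^ CARD('p) = f $$ n"
  shows "f \<in> Sp_poly k"
proof (rule Sp_poly_limit)
  let ?g = "\<lambda>n. \<Sum>i<n. fls_const (f $$ int i) * fls_X ^ i"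
  have const: "fls_const (f $$ n) \<in> Sp_poly k" for n
  proof -
    obtain j where "f $$ n = - of_nat j"
      using frobenius_fixed_is_of_nat[OF assms(2)] by blast
    then have "fls_const (f $$ n) = - of_nat j"
      by (simp add: fls_of_nat)
    then show ?thesis
      by (simp add: Sp_poly_intros)
  qed
  show "?g n \<in> Sp_poly k" for n
    using tgen_in_Sp_poly[of 0 k] by (intro Sp_poly_intros const) (simp add: tgen_0)
  show "ord_ge (int n) (f - ?g n)" for n
    unfolding ord_ge_def
  proof (intro allI impI)
    fix m assume m: "m < int n"
    have "?g n $$ m = (\<Sum>i<n. if i = nat m \<and> m \<ge> 0 then f $$ m else 0)"
      unfolding fls_nth_sum by (rule sum.cong) (auto simp: fls_X_power_times_conv_shift)
    also have "\<dots> = f $$ m"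
      using m assms(1) by (cases "m \<ge> 0") (auto simp: ord_ge_def)
    finally show "(f - ?g n) $$ m = 0" by simp
  qed
qed

section \<open>Solving the equation at one level\<close>

lemma frobenius_add: "((f :: 'p::prime_card Rp) + g) ^ CARD('p) = f ^ CARD('p) + g ^ CARD('p)"
  by (rule freshmans_dream) (simp_all only: CHAR_Rp prime_CARD)

lemma frobenius_diff: "((f :: 'p::prime_card Rp) - g) ^ CARD('p) = f ^ CARD('p) - g ^ CARD('p)"
  using frobenius_add[of "f - g" g] by simp

text \<open>
  Since \<open>t\<close> has positive order, the right-hand side is a contraction in \<open>g\<close> for the \<open>x\<close>-adic metric.
  In terms of \<open>v = t ^ p * g\<close> the equation reads \<open>v = (t * b) ^ p + v ^ p\<close>; solving for \<open>g\<close> records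
  that \<open>v\<close> is divisible by \<open>t ^ p\<close> within the ring.
\<close>
lemma artin_schreier_solution:
  fixes t b :: "'p::prime_card Rp"
  assumes t: "t \<in> Sp_poly k" "ord_ge 1 t" and b: "b \<in> Sp_poly k"
  defines "p \<equiv> CARD('p)"
  obtains g where "g \<in> Sp_poly k" "g = b ^ p + t ^ (p * (p - 1)) * g ^ p"
proof -
  define \<Phi> where "\<Phi> g = b ^ p + t ^ (p * (p - 1)) * g ^ p" for g
  have p2: "p \<ge> 2"
    unfolding p_def by (rule CARD_prime_ge_2)
  have t_ord: "ord_ge 1 (t ^ (p * (p - 1)))"
  proof (rule ord_ge_mono)
    show "ord_ge (int (p * (p - 1)) * 1) (t ^ (p * (p - 1)))"
      by (rule ord_ge_power[OF t(2)])
    show "1 \<le> int (p * (p - 1)) * 1"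
      using of_nat_mono[OF mult_le_mono[of 1 p 1 "p - 1"], where 'a = int] p2
      by (simp only: mult_1_right of_nat_1)
  qed
  have contract: "ord_ge (int (Suc n)) (\<Phi> f - \<Phi> g)" if "ord_ge (int n) (f - g)" for f g n
  proof -
    have "\<Phi> f - \<Phi> g = t ^ (p * (p - 1)) * (f - g) ^ p"
      by (simp add: \<Phi>_def frobenius_diff p_def algebra_simps)
    moreover have "ord_ge (int n) ((f - g) ^ p)"
      using ord_ge_power[OF that, of p]
      by (rule ord_ge_mono) (use p2 mult_right_mono[of 1 "int p" "int n"] in simp)
    ultimately show ?thesis
      using t_ord by (auto intro: ord_ge_mult_le)
  qed
  have S: "(\<Phi> ^^ n) 0 \<in> Sp_poly k" for n
    by (induction n) (auto simp: \<Phi>_def intro!: Sp_poly_intros t b)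
  have step: "ord_ge (int n) ((\<Phi> ^^ Suc n) 0 - (\<Phi> ^^ n) 0)" for n
  proof (induction n)
    case 0
    then show ?case
      using Sp_poly_ord_ge[OF S[of 1]] by simp
  next
    case (Suc n)
    then show ?case
      using contract[OF Suc] by simp
  qed
  obtain g where g: "\<And>n. ord_ge (int n) (g - (\<Phi> ^^ n) 0)"
    using fls_limit_exists[of "\<lambda>n. (\<Phi> ^^ n) 0"] step Sp_poly_ord_ge[OF S] by blast
  have "ord_ge (int n) (g - \<Phi> g)" for n
  proof -
    have "ord_ge (int (Suc n)) (\<Phi> ((\<Phi> ^^ n) 0) - \<Phi> g)"
      using contract[of n "(\<Phi> ^^ n) 0" g] g[of n] by (simp add: ord_ge_diff_commute)
    then have "ord_ge (int (Suc n)) (g - \<Phi> g)"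
      using ord_ge_diff_trans[OF g[of "Suc n"]] by simp
    then show ?thesis
      by (rule ord_ge_mono) simp
  qed
  then have "g - \<Phi> g = 0"
    by (rule ord_ge_all_imp_eq_0)
  moreover have "g \<in> Sp_poly k"
    using S g by (rule Sp_poly_limit)
  ultimately show ?thesis
    using that[of g] by (simp add: \<Phi>_def)
qed

text \<open>
  For \<open>b\<close> constant, the differential equation \<open>\<partial>h = - b \<partial>t h\<close> would be solved by \<open>exp (- t b)\<close>.  The truncated
  exponential at \<open>u = t b\<close> and \<open>v = t ^ p g\<close> solves it up to the error \<open>t ^ (p - 1) g \<partial>t\<close>, in which
  \<open>g\<close> is again constant, because the equation for \<open>g\<close> exhibits it as a \<open>p\<close>-th power.
\<close>
lemma level_step:
  fixes t b :: "'p::prime_card Rp"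
  assumes t: "t \<in> Sp_poly k" "ord_ge 1 t" "t \<in> ratfun k" "t \<noteq> 0"
    and b: "b \<in> Sp_poly k" "Rp_deriv b = 0" "algebraic_over (ratfun k) b"
  obtains h s g where
    "h = 1 + t * s" "s \<in> Sp_poly k" "algebraic_over (ratfun k) h"
    "g \<in> Sp_poly k" "Rp_deriv g = 0" "algebraic_over (ratfun k) g"
    "Rp_deriv h = - (Rp_deriv t * b + t ^ (CARD('p) - 1) * Rp_deriv t * g) * h"
proof -
  let ?p = "CARD('p)"
  obtain g where g: "g \<in> Sp_poly k" "g = b ^ ?p + t ^ (?p * (?p - 1)) * g ^ ?p"
    using artin_schreier_solution[OF t(1,2) b(1)] by blast
  obtain N where N: "?p = Suc (Suc N)"
    using CARD_prime_ge_2[where 'p = 'p] by (metis add_2_eq_Suc le_Suc_ex)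
  have const_power: "Rp_deriv (f ^ ?p) = 0" for f :: "'p Rp"
    using Rp.d_power_CHAR[of f] by (simp add: CHAR_zrat)
  \<comment> \<open>a \<open>p\<close>-th power, hence a constant\<close>
  have "g = (b + t ^ (?p - 1) * g) ^ ?p"
    by (subst g(2)) (simp add: frobenius_add power_mult_distrib mult.commute flip: power_mult)
  then have dg: "Rp_deriv g = 0"
    using const_power by metis
  define u where "u = t * b"
  define v where "v = t ^ ?p * g"
  have "v = t ^ ?p * (b ^ ?p + t ^ (?p * (?p - 1)) * g ^ ?p)"
    unfolding v_def by (subst g(2)) simp
  also have "\<dots> = (t * b) ^ ?p + (t ^ ?p * t ^ (?p * (?p - 1))) * g ^ ?p"
    by (simp add: algebra_simps)
  also have "t ^ ?p * t ^ (?p * (?p - 1)) = (t ^ ?p) ^ ?p"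
  proof -
    have "?p + ?p * (?p - 1) = ?p * ?p"
      by (simp add: N)
    then show ?thesis
      by (simp only: flip: power_add power_mult)
  qed
  also have "(t ^ ?p) ^ ?p * g ^ ?p = v ^ ?p"
    by (simp only: v_def power_mult_distrib)
  finally have v: "v = u ^ ?p + v ^ ?p"
    unfolding u_def .
  have dv: "Rp_deriv v = 0"
    by (simp add: v_def Rp_deriv_mult dg const_power)
  have du: "Rp_deriv u = (Rp_deriv t / t) * u"
    using t(4) by (simp add: u_def Rp_deriv_mult b(2))
  define h where "h = trunc_exp ?p u v"
  define s where "s = b * (\<Sum>i<?p - 1. (- u) ^ i * (\<Prod>j=Suc (Suc i)..<?p. v + of_nat j))
      - t ^ (?p - 1) * g * v ^ N"
  have in_S: "u \<in> Sp_poly k" "v \<in> Sp_poly k"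
    unfolding u_def v_def by (intro Sp_poly_intros t b g)+
  have "v ^ (?p - 1) = v * v ^ N"
    by (simp add: N)
  also have "\<dots> = t * (t ^ (?p - 1) * g * v ^ N)"
    by (simp add: v_def N)
  finally have "h = 1 + t * s"
    unfolding h_def trunc_exp_eq[OF prime_CARD CHAR_Rp] s_def u_def
    by (simp add: algebra_simps)
  moreover have "s \<in> Sp_poly k"
    unfolding s_def by (intro Sp_poly_intros t b g in_S)
  moreover have alg_g: "algebraic_over (ratfun k) g"
  proof -
    \<comment> \<open>dividing by \<open>t ^ (p * (p - 1))\<close> makes the equation monic: \<open>g ^ p = q * g - q * b ^ p\<close>\<close>
    define q where "q = inverse (t ^ (?p * (?p - 1)))"
    define c where "c i = (if i = 0 then - q * b ^ ?p else if i = 1 then q else 0)" for i :: nat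
    have q: "algebraic_over (ratfun k) q"
      unfolding q_def by (intro ratfun.algebraic_base ratfun.inverse_closed ratfun.power_closed t)
    have "g ^ ?p = q * (t ^ (?p * (?p - 1)) * g ^ ?p)"
      using t(4) by (simp add: q_def)
    also have "t ^ (?p * (?p - 1)) * g ^ ?p = g - b ^ ?p"
      using g(2) by (metis add_diff_cancel_left')
    also have "q * (g - b ^ ?p) = (\<Sum>i<?p. c i * g ^ i)"
      unfolding N sum.lessThan_Suc_shift by (simp add: c_def N algebra_simps)
    finally have monic: "g ^ ?p = (\<Sum>i<?p. c i * g ^ i)" .
    have zero: "algebraic_over (ratfun k) (0 :: 'p Rp)"
      by (rule ratfun.algebraic_base[OF ratfun.zero_closed])
    have "algebraic_over (ratfun k) (c i)" for i
      using q zero ratfun.algebraic_uminus[OF ratfun.algebraic_mult[OF q ratfun.algebraic_power[OF b(3)]]]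
      by (simp add: c_def)
    then show ?thesis
      using monic by (rule ratfun.algebraic_root_of_monic)
  qed
  moreover have "algebraic_over (ratfun k) h"
    unfolding h_def trunc_exp_def u_def v_def using alg_g b(3) ratfun.algebraic_base[OF t(3)]
    by (intro ratfun.algebraic_uminus ratfun.algebraic_sum ratfun.algebraic_mult
        ratfun.algebraic_power ratfun.algebraic_prod ratfun.algebraic_add ratfun.algebraic_of_nat)
  moreover have "Rp_deriv h = - (Rp_deriv t * b + t ^ (?p - 1) * Rp_deriv t * g) * h"
  proof -
    have "Rp_deriv h = - (Rp_deriv t / t) * (u + v) * h"
      unfolding h_def by (rule Rp.d_trunc_exp[OF prime_CARD CHAR_Rp du dv v])
    also have "- (Rp_deriv t / t) * (u + v) = - (Rp_deriv t * b + t ^ (?p - 1) * Rp_deriv t * g)"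
      using t(4) by (simp add: u_def v_def N field_simps)
    finally show ?thesis .
  qed
  ultimately show ?thesis
    using that g(1) dg by blast
qed

section \<open>The projections \<open>\<pi>\<^sub>i\<close>\<close>

lemma zpoly_subst_superset:
  assumes "finite M" "Poly_Mapping.keys P \<subseteq> M"
  shows "zpoly_subst \<sigma> P = (\<Sum>m\<in>M. to_fract (Poly_Mapping.single 0 (Poly_Mapping.lookup P m)) *
     (\<Prod>j\<in>Poly_Mapping.keys m. \<sigma> j ^ Poly_Mapping.lookup m j))"
  unfolding zpoly_subst_def using assms
  by (intro sum.mono_neutral_left) (auto simp: in_keys_iff)

lemma zpoly_subst_add: "zpoly_subst \<sigma> (P + Q) = zpoly_subst \<sigma> P + zpoly_subst \<sigma> Q"
proof -
  let ?M = "Poly_Mapping.keys P \<union> Poly_Mapping.keys Q"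
  have "Poly_Mapping.keys (P + Q) \<subseteq> ?M" by (rule keys_add)
  then show ?thesis
    by (simp add: zpoly_subst_superset[of ?M] lookup_add single_add algebra_simps sum.distrib)
qed

lemma zpoly_subst_0: "zpoly_subst \<sigma> 0 = 0"
  by (simp add: zpoly_subst_def)

lemma zpoly_subst_single:
  "zpoly_subst \<sigma> (Poly_Mapping.single m c) = to_fract (Poly_Mapping.single 0 c) *
     (\<Prod>j\<in>Poly_Mapping.keys m. \<sigma> j ^ Poly_Mapping.lookup m j)"
  by (simp add: zpoly_subst_def)

lemma zpoly_subst_1: "zpoly_subst \<sigma> 1 = 1"
  using zpoly_subst_single[of \<sigma> 0 1] by simp

lemma zpoly_subst_mult: "zpoly_subst \<sigma> (P * Q) = zpoly_subst \<sigma> P * zpoly_subst \<sigma> Q"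
proof (induction P rule: zpoly_induct)
  case (2 m c)
  show ?case
  proof (induction Q rule: zpoly_induct)
    case (2 n d)
    let ?M = "Poly_Mapping.keys m \<union> Poly_Mapping.keys n"
    have *: "(\<Prod>j\<in>Poly_Mapping.keys k. \<sigma> j ^ Poly_Mapping.lookup k j)
        = (\<Prod>j\<in>?M. \<sigma> j ^ Poly_Mapping.lookup k j)" if "Poly_Mapping.keys k \<subseteq> ?M" for k
      using that by (intro prod.mono_neutral_left) (auto simp: in_keys_iff)
    have "(\<Prod>j\<in>Poly_Mapping.keys (m + n). \<sigma> j ^ Poly_Mapping.lookup (m + n) j)
        = (\<Prod>j\<in>Poly_Mapping.keys m. \<sigma> j ^ Poly_Mapping.lookup m j)
        * (\<Prod>j\<in>Poly_Mapping.keys n. \<sigma> j ^ Poly_Mapping.lookup n j)"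
      using *[OF keys_add] *[of m] *[of n] by (simp add: lookup_add power_add prod.distrib)
    moreover have "to_fract (Poly_Mapping.single 0 (c * d)) =
        to_fract (Poly_Mapping.single 0 c) * to_fract (Poly_Mapping.single (0 :: nat \<Rightarrow>\<^sub>0 nat) d)"
      by (simp add: mult_single flip: to_fract_mult)
    ultimately show ?case
      by (simp add: mult_single zpoly_subst_single mult_ac)
  qed (simp_all add: zpoly_subst_add zpoly_subst_0 algebra_simps)
qed (simp_all add: zpoly_subst_add zpoly_subst_0 algebra_simps)

text \<open>
  The action of \<open>\<pi>\<^sub>i\<close> on a single coefficient.  It is a ring homomorphism on the polynomials only;
  elsewhere \<open>the_inv\<close> gives an unspecified value.
\<close>
definition kill_vars :: "nat \<Rightarrow> 'p::prime_card zrat \<Rightarrow> 'p zrat" where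
  "kill_vars i c = zpoly_subst (\<lambda>j. if j < i then zc j else 0) (the_inv to_fract c)"

lemma kill_vars_to_fract:
  "kill_vars i (to_fract P) = zpoly_subst (\<lambda>j. if j < i then zc j else 0) P"
  unfolding kill_vars_def by (simp add: the_inv_f_f inj_def)

lemma kill_vars_0 [simp]: "kill_vars i 0 = 0"
  using kill_vars_to_fract[of i 0] by (simp add: zpoly_subst_0)

lemma kill_vars_1 [simp]: "kill_vars i 1 = 1"
  using kill_vars_to_fract[of i 1] by (simp add: zpoly_subst_1)

lemma kill_vars_add:
  "c \<in> range to_fract \<Longrightarrow> d \<in> range to_fract \<Longrightarrow> kill_vars i (c + d) = kill_vars i c + kill_vars i d"
  by (auto simp: kill_vars_to_fract zpoly_subst_add simp flip: to_fract_add)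

lemma kill_vars_mult:
  "c \<in> range to_fract \<Longrightarrow> d \<in> range to_fract \<Longrightarrow> kill_vars i (c * d) = kill_vars i c * kill_vars i d"
  by (auto simp: kill_vars_to_fract zpoly_subst_mult simp flip: to_fract_mult)

lemma kill_vars_diff:
  assumes "c \<in> range to_fract" "d \<in> range to_fract"
  shows "kill_vars i (c - d) = kill_vars i c - kill_vars i d"
proof -
  have "c - d \<in> range to_fract"
    using assms by (auto simp flip: to_fract_diff)
  then show ?thesis
    using kill_vars_add[of "c - d" d i] assms(2) by simp
qed

lemma range_to_fract_add:
  "c \<in> range to_fract \<Longrightarrow> d \<in> range to_fract \<Longrightarrow> c + d \<in> range to_fract"
  by (auto simp flip: to_fract_add)

lemma range_to_fract_sum: "(\<And>j. j \<in> J \<Longrightarrow> f j \<in> range to_fract) \<Longrightarrow> sum f J \<in> range to_fract"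
  by (induction J rule: infinite_finite_induct)
    (auto intro: range_to_fract_add range_eqI[of _ _ 0])

lemma kill_vars_sum:
  "(\<And>j. j \<in> J \<Longrightarrow> f j \<in> range to_fract) \<Longrightarrow> kill_vars i (sum f J) = (\<Sum>j\<in>J. kill_vars i (f j))"
  by (induction J rule: infinite_finite_induct)
    (simp_all add: kill_vars_add range_to_fract_sum)

lemma kill_vars_zc: "kill_vars i (zc j) = (if j < i then zc j else 0)"
  unfolding zc_def by (simp add: kill_vars_to_fract zpoly_subst_single) (simp add: zc_def)

lemma zpol_in_range: "c \<in> zpol k \<Longrightarrow> c \<in> range to_fract"
  unfolding zpol_def
proof (induction rule: ring_gen.induct)
  case one
  show ?case by (rule range_eqI[of _ _ 1]) simp
qed (auto simp: zc_def simp flip: to_fract_diff to_fract_mult)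

lemma kill_vars_zpol: "c \<in> zpol i \<Longrightarrow> kill_vars i c = c"
  unfolding zpol_def
proof (induction rule: ring_gen.induct)
  case (diff a b)
  then show ?case
    using zpol_in_range[unfolded zpol_def] by (metis kill_vars_diff)
next
  case (mult a b)
  then show ?case
    using zpol_in_range[unfolded zpol_def] by (metis kill_vars_mult)
qed (auto simp: kill_vars_zc)

lemma proj_nth: "proj i f $$ n = kill_vars i (f $$ n)"
proof -
  have "proj i f = map_coeffs (kill_vars i) f"
    by (simp add: proj_def kill_vars_def[abs_def])
  then show ?thesis
    by (simp add: map_coeffs_nth)
qed

lemma proj_add: "poly_coeffs f \<Longrightarrow> poly_coeffs g \<Longrightarrow> proj i (f + g) = proj i f + proj i g"
  by (rule fls_eqI) (simp add: proj_nth kill_vars_add poly_coeffs_def)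

lemma proj_mult:
  assumes "poly_coeffs f" "poly_coeffs g"
  shows "proj i (f * g) = proj i f * proj i g"
proof (rule fls_eqI)
  fix n
  define a where "a = min (fls_subdegree f) (fls_subdegree (proj i f))"
  define b where "b = max (n - fls_subdegree g) (n - fls_subdegree (proj i g))"
  have prod: "f $$ k * g $$ l \<in> range to_fract" for k l
  proof -
    obtain P Q where "f $$ k = to_fract P" "g $$ l = to_fract Q"
      using assms unfolding poly_coeffs_def by blast
    then show ?thesis by (simp flip: to_fract_mult)
  qed
  have "proj i (f * g) $$ n = kill_vars i (\<Sum>k=a..b. f $$ k * g $$ (n - k))"
    by (subst proj_nth, subst fls_times_nth_wide[of a _ _ _ b]) (simp_all add: a_def b_def)
  also have "\<dots> = (\<Sum>k=a..b. proj i f $$ k * proj i g $$ (n - k))"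
    using assms by (simp add: kill_vars_sum prod kill_vars_mult proj_nth poly_coeffs_def)
  also have "\<dots> = (proj i f * proj i g) $$ n"
    by (subst fls_times_nth_wide[of a _ _ _ b]) (simp_all add: a_def b_def)
  finally show "proj i (f * g) $$ n = (proj i f * proj i g) $$ n" .
qed

lemma Sp_poly_poly_coeffs: "f \<in> Sp_poly k \<Longrightarrow> poly_coeffs f"
  by (auto simp: Sp_poly_def poly_coeffs_def intro: zpol_in_range)

lemma proj_Sp_poly: "f \<in> Sp_poly i \<Longrightarrow> proj i f = f"
  by (rule fls_eqI) (simp add: proj_nth kill_vars_zpol Sp_poly_def)

text \<open>
  For \<open>k > i\<close> the generator \<open>t\<^sub>k\<close> contains the variable \<open>z\<^sub>k\<close>, which \<open>\<pi>\<^sub>i\<close> sets to zero.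
\<close>
lemma proj_tgen:
  assumes "i < k"
  shows "proj i (tgen k :: 'p::prime_card Rp) = 0"
proof -
  obtain l where l: "k = Suc l" "i \<le> l"
    using assms by (cases k) auto
  have pc: "poly_coeffs (zvar l :: 'p Rp)"
    unfolding poly_coeffs_def
  proof
    fix n
    have "zvar l $$ n \<in> zpol (Suc l)"
      by (auto simp: zvar_def zpol_def intro: ring_gen_zero ring_gen.base)
    then show "zvar l $$ n \<in> range to_fract"
      by (rule zpol_in_range)
  qed
  have "proj i (zvar l :: 'p Rp) = 0"
    using l by (intro fls_eqI) (simp add: proj_nth zvar_def kill_vars_zc)
  moreover have "poly_coeffs (tgen l ^ CARD('p) :: 'p Rp)"
    by (intro Sp_poly_poly_coeffs[of _ l] Sp_poly_power tgen_in_Sp_poly) simp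
  ultimately show ?thesis
    using pc by (simp add: l tgen_Suc proj_mult)
qed

lemma proj_prod:
  assumes "\<And>j. j \<in> J \<Longrightarrow> f j \<in> Sp_poly k"
  shows "proj i (prod f J) = (\<Prod>j\<in>J. proj i (f j))"
proof -
  have one: "proj i 1 = 1"
    using proj_Sp_poly[OF Sp_poly_one] .
  show ?thesis
    using assms
  proof (induction J rule: infinite_finite_induct)
    case (insert x J)
    have "poly_coeffs (f x)" "poly_coeffs (prod f J)"
      using insert.prems by (auto intro!: Sp_poly_poly_coeffs Sp_poly_prod)
    then show ?case
      using insert by (simp add: proj_mult)
  qed (simp_all add: one)
qed

section \<open>Construction of the factors\<close>

text \<open>
  The equation \<open>f(x) ^ p = f(x ^ p)\<close> holds for \<open>f = x\<close> and is preserved by the field operations;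
  for a Laurent series it says that Frobenius fixes all coefficients.
\<close>
lemma ratfun_0_frobenius:
  fixes f :: "'p::prime_card Rp"
  assumes "f \<in> ratfun 0"
  shows "(f $$ n) ^ CARD('p) = f $$ n"
proof -
  let ?p = "CARD('p)"
  have p0: "?p > 0" by simp
  have "f \<in> field_gen {fls_X}"
    using assms by (simp add: ratfun_def)
  then have "f ^ ?p = fls_compose_power f ?p"
  proof induction
    case (base f)
    then show ?case by (simp add: fls_X_power_conv_shift_1)
  next
    case (inv f)
    show ?case
    proof (cases "f = 0")
      case False
      then have "f ^ ?p * fls_compose_power (inverse f) ?p = 1"
        by (simp add: inv flip: fls_compose_power_mult)
      then show ?thesis
        using False by (simp add: power_inverse field_simps)
    qed simp
  qed (simp_all add: frobenius_diff power_mult_distrib)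
  then have "(f ^ ?p) $$ (int ?p * n) = fls_compose_power f ?p $$ (int ?p * n)"
    by simp
  then show ?thesis
    by (simp add: frobenius_nth[OF prime_CARD CHAR_zrat] fls_nth_compose_power)
qed

lemma Rp_upto_0_frobenius:
  fixes f :: "'p::prime_card Rp"
  assumes "f \<in> Rp_upto 0"
  shows "(f $$ n) ^ CARD('p) = f $$ n"
proof -
  have frob: "(c - d) ^ CARD('p) = c ^ CARD('p) - d ^ CARD('p)" for c d :: "'p zrat"
    using freshmans_dream[OF _ CHAR_zrat[symmetric], of "c - d" d] by (simp add: CHAR_zrat prime_CARD)
  have "f $$ n \<in> field_gen {}"
    using assms by (simp add: Rp_upto_def zrat_upto_def)
  then show ?thesis
    by induction (simp_all add: frob power_mult_distrib power_inverse)
qed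

lemma product_of_one_plus_multiples:
  assumes "\<And>i. i \<in> I \<Longrightarrow> \<exists>s\<in>Sp_poly k. f i = 1 + t * s" "t \<in> Sp_poly k"
  shows "\<exists>s\<in>Sp_poly k. prod f I = 1 + t * s"
  using assms
proof (induction I rule: infinite_finite_induct)
  case (insert i I)
  then obtain r s where rs: "r \<in> Sp_poly k" "s \<in> Sp_poly k" "f i = 1 + t * r" "prod f I = 1 + t * s"
    by blast
  then have "prod f (insert i I) = 1 + t * (r + s + t * r * s)"
    using insert.hyps by (simp add: algebra_simps)
  then show ?case
    using rs insert.prems by (intro bexI[of _ "r + s + t * r * s"]) (auto intro: Sp_poly_intros)
qed (auto intro!: bexI[of _ 0] Sp_poly_zero)

text \<open>
  The condition on the error \<open>b \<partial>t\<^sub>k\<^sub>+\<^sub>1\<close> that remains in the logarithmic derivative of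
  \<open>h\<^sub>0 \<cdots> h\<^sub>k\<close>.
\<close>
definition level :: "nat \<Rightarrow> 'p::prime_card Rp \<Rightarrow> bool" where
  "level k b \<longleftrightarrow> b \<in> Sp_poly k \<and> Rp_deriv b = 0 \<and> algebraic_over (ratfun k) b"

definition admissible_factor :: "nat \<Rightarrow> 'p::prime_card Rp \<Rightarrow> bool" where
  "admissible_factor k h \<longleftrightarrow> (\<exists>s\<in>Sp_poly k. h = 1 + tgen k * s) \<and> algebraic_over (ratfun k) h"

text \<open>
  In the decomposition \<open>a = \<Sum>i<p. x ^ i \<alpha>\<^sub>i ^ p\<close> the coefficients \<open>\<alpha>\<^sub>i ^ p\<close> are constants.  For \<open>i < p - 1\<close>
  the summand is \<open>\<alpha>\<^sub>i ^ p / (i + 1)\<close> times the derivative of \<open>x ^ (i + 1)\<close>, so \<open>level_step\<close> with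
  \<open>t = x ^ (i + 1)\<close> removes it at the cost of a constant multiple of \<open>x ^ (p - 1)\<close>.  The last summand
  already is a constant multiple of \<open>x ^ (p - 1) = \<partial>t\<^sub>1\<close> and has no primitive in \<open>x\<close>: all these
  multiples together form the error handed on to the next level.
\<close>
lemma base_factor_exists:
  fixes a :: "'p::prime_card Rp"
  assumes a: "algebraic_over (ratfun 0) a" "ord_ge 0 a" "\<And>n. (a $$ n) ^ CARD('p) = a $$ n"
  obtains h b where "admissible_factor 0 h" "level 0 b"
    "Rp_deriv h = (- a + Rp_deriv (tgen 1) * b) * h"
proof -
  let ?p = "CARD('p)"
  obtain N where N: "?p = Suc (Suc N)"
    using CARD_prime_ge_2[where 'p = 'p] by (metis add_2_eq_Suc le_Suc_ex)
  obtain \<alpha> where \<alpha>: "\<And>i. algebraic_over (ratfun 0) (\<alpha> i)" "a = (\<Sum>j<?p. fls_X ^ j * \<alpha> j ^ ?p)"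
    using ratfun.algebraic_p_decomposition[OF ratfun_0_p_decomposable a(1)] by blast
  have \<alpha>_nth: "(\<alpha> i $$ n) ^ ?p = a $$ (int ?p * n + int i)" if "i < ?p" for i n
    using p_decomposition_nth[OF prime_CARD CHAR_zrat that, of \<alpha> n] \<alpha>(2) by simp
  have \<alpha>_S: "\<alpha> i \<in> Sp_poly 0" if i: "i < ?p" for i
  proof (rule prime_field_series_in_Sp_poly)
    show "ord_ge 0 (\<alpha> i)"
      unfolding ord_ge_def
    proof (intro allI impI)
      fix n :: int assume "n < 0"
      then have "int ?p * n \<le> int ?p * - 1"
        by (intro mult_left_mono) auto
      then have "int ?p * n + int i < 0"
        using i by simp
      then have "(\<alpha> i $$ n) ^ ?p = 0"
        using \<alpha>_nth[OF i] a(2) by (simp add: ord_ge_def)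
      then show "\<alpha> i $$ n = 0" by simp
    qed
    show "(\<alpha> i $$ n) ^ ?p = \<alpha> i $$ n" for n
    proof -
      \<comment> \<open>the \<open>p\<close>-th power of this coefficient is a coefficient of \<open>a\<close>, hence fixed by Frobenius, which is injective\<close>
      have "(\<alpha> i $$ n - (\<alpha> i $$ n) ^ ?p) ^ ?p + ((\<alpha> i $$ n) ^ ?p) ^ ?p = (\<alpha> i $$ n) ^ ?p"
        using freshmans_dream[OF _ CHAR_zrat[symmetric], of "\<alpha> i $$ n - (\<alpha> i $$ n) ^ ?p" "(\<alpha> i $$ n) ^ ?p"]
        by (simp add: CHAR_zrat prime_CARD)
      then have "(\<alpha> i $$ n - (\<alpha> i $$ n) ^ ?p) ^ ?p = 0"
        using a(3) by (simp add: \<alpha>_nth[OF i])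
      then show ?thesis by simp
    qed
  qed
  have const_power: "Rp_deriv (f ^ ?p) = 0" for f :: "'p Rp"
    using Rp.d_power_CHAR[of f] by (simp add: CHAR_zrat)
  have X_S: "fls_X \<in> (Sp_poly 0 :: 'p Rp set)"
    using tgen_in_Sp_poly[of 0 0] by (simp add: tgen_0)
  define R where "R i h g \<longleftrightarrow>
      (\<exists>s\<in>Sp_poly 0. h = 1 + fls_X * s) \<and> algebraic_over (ratfun 0) h \<and> level 0 g \<and>
      Rp_deriv h = - (fls_X ^ i * \<alpha> i ^ ?p + fls_X ^ (?p - 1) * fls_X ^ (i * ?p) * g) * h" for i h g
  have "\<exists>h g. R i h g" if i: "i < ?p - 1" for i
  proof -
    let ?t = "fls_X ^ Suc i :: 'p Rp" and ?m = "of_nat (Suc i) :: 'p Rp"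
    \<comment> \<open>\<open>?m ^ N\<close> is the inverse of \<open>i + 1\<close> by Fermat's little theorem, written as a natural number\<close>
    define b where "b = ?m ^ N * \<alpha> i ^ ?p"
    have "?m ^ ?p = ?m"
      using freshmans_dream_sum[OF _ CHAR_Rp[symmetric], of "\<lambda>_. 1" "{..<Suc i}"]
      by (simp add: CHAR_zrat prime_CARD del: of_nat_Suc)
    then have "?m * (?m * ?m ^ N) = ?m * 1"
      by (simp add: N del: of_nat_Suc)
    moreover have "?m \<noteq> 0"
      using i by (auto simp: of_nat_eq_0_iff_char_dvd CHAR_zrat simp del: of_nat_Suc dest: dvd_imp_le)
    ultimately have m: "?m * ?m ^ N = 1"
      by (simp del: of_nat_Suc)
    have dm: "Rp_deriv (?m ^ N) = 0"
      by (simp add: Rp.d_power del: of_nat_Suc)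
    have b: "b \<in> Sp_poly 0" "Rp_deriv b = 0" "algebraic_over (ratfun 0) b"
      using i \<alpha>(1) dm unfolding b_def
      by (auto simp: Rp_deriv_mult const_power simp del: of_nat_Suc
          intro!: Sp_poly_intros \<alpha>_S ratfun.algebraic_mult ratfun.algebraic_power ratfun.algebraic_of_nat)
    have "?t \<in> Sp_poly 0" "ord_ge 1 ?t" "?t \<in> ratfun 0" "?t \<noteq> 0"
      using X_S ratfun.X_closed by (auto simp: ord_ge_def intro: Sp_poly_power ratfun.power_closed simp del: power_Suc)
    from level_step[OF this b] obtain h s g where h: "h = 1 + ?t * s" "s \<in> Sp_poly 0"
      "algebraic_over (ratfun 0) h" "g \<in> Sp_poly 0" "Rp_deriv g = 0" "algebraic_over (ratfun 0) g"
      "Rp_deriv h = - (Rp_deriv ?t * b + ?t ^ (?p - 1) * Rp_deriv ?t * g) * h"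
      by blast
    have dt: "Rp_deriv ?t = ?m * fls_X ^ i"
      by (simp add: Rp.d_power Rp_deriv_X del: power_Suc of_nat_Suc)
    have "Rp_deriv ?t * b = fls_X ^ i * (?m * ?m ^ N) * \<alpha> i ^ ?p"
      unfolding dt b_def by (simp only: mult_ac)
    then have 1: "Rp_deriv ?t * b = fls_X ^ i * \<alpha> i ^ ?p"
      by (simp only: m mult_1_right)
    have "Suc i * (?p - 1) + i = (?p - 1) + i * ?p"
      by (simp add: N)
    then have "?t ^ (?p - 1) * fls_X ^ i = fls_X ^ (?p - 1) * fls_X ^ (i * ?p)"
      by (simp only: flip: power_mult power_add)
    moreover have "?t ^ (?p - 1) * Rp_deriv ?t * g = (?t ^ (?p - 1) * fls_X ^ i) * (?m * g)"
      unfolding dt by (simp only: mult_ac)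
    ultimately have 2: "?t ^ (?p - 1) * Rp_deriv ?t * g = fls_X ^ (?p - 1) * fls_X ^ (i * ?p) * (?m * g)"
      by (simp only:)
    have "level 0 (?m * g)"
      unfolding level_def using h
      by (auto simp: Rp_deriv_mult simp del: of_nat_Suc
          intro!: Sp_poly_intros ratfun.algebraic_mult ratfun.algebraic_of_nat)
    moreover have "h = 1 + fls_X * (fls_X ^ i * s)" "fls_X ^ i * s \<in> Sp_poly 0"
      using h(1,2) X_S by (auto simp: mult.assoc intro: Sp_poly_intros)
    ultimately show ?thesis
      using h(3,7) unfolding 1 2 R_def by blast
  qed
  then obtain h g where "\<And>i. i < ?p - 1 \<Longrightarrow> R i (h i) (g i)"
    by metis
  then have hg: "\<And>i. i < ?p - 1 \<Longrightarrow> \<exists>s\<in>Sp_poly 0. h i = 1 + fls_X * s"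
      "\<And>i. i < ?p - 1 \<Longrightarrow> algebraic_over (ratfun 0) (h i)" "\<And>i. i < ?p - 1 \<Longrightarrow> level 0 (g i)"
      "\<And>i. i < ?p - 1 \<Longrightarrow>
        Rp_deriv (h i) = - (fls_X ^ i * \<alpha> i ^ ?p + fls_X ^ (?p - 1) * fls_X ^ (i * ?p) * g i) * h i"
    unfolding R_def by blast+
  define H where "H = (\<Prod>i<?p - 1. h i)"
  define b where "b = \<alpha> (?p - 1) ^ ?p - (\<Sum>i<?p - 1. fls_X ^ (i * ?p) * g i)"
  have "a = (\<Sum>i<?p - 1. fls_X ^ i * \<alpha> i ^ ?p) + fls_X ^ (?p - 1) * \<alpha> (?p - 1) ^ ?p"
    by (subst \<alpha>(2)) (simp add: N)
  then have log: "(\<Sum>i<?p - 1. - (fls_X ^ i * \<alpha> i ^ ?p + fls_X ^ (?p - 1) * fls_X ^ (i * ?p) * g i))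
      = - a + fls_X ^ (?p - 1) * b"
    unfolding b_def by (simp add: sum.distrib sum_negf sum_subtractf sum_distrib_left algebra_simps)
  have "Rp_deriv H =
      (\<Sum>i<?p - 1. - (fls_X ^ i * \<alpha> i ^ ?p + fls_X ^ (?p - 1) * fls_X ^ (i * ?p) * g i)) * H"
    unfolding H_def using hg(4) by (intro Rp.d_prod_logarithmic) auto
  then have "Rp_deriv H = (- a + Rp_deriv (tgen 1) * b) * H"
    unfolding log using deriv_tgen_Suc[of 0, where 'p = 'p] by (simp add: tgen_0 Rp_deriv_X)
  moreover have "admissible_factor 0 H"
    unfolding admissible_factor_def H_def tgen_0 using hg(1,2) X_S
    by (auto intro!: product_of_one_plus_multiples ratfun.algebraic_prod)
  moreover have "level 0 b"
  proof -
    have "Rp_deriv (fls_X ^ (i * ?p) * g i) = 0" if "i < ?p - 1" for i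
      using hg(3)[OF that] const_power[of "fls_X ^ i"] by (simp add: Rp_deriv_mult level_def flip: power_mult)
    then have "Rp_deriv b = 0"
      by (simp add: b_def Rp.d_diff Rp.d_sum const_power)
    moreover have "b \<in> Sp_poly 0"
      unfolding b_def using hg(3) X_S \<alpha>_S[of "?p - 1"] N
      by (intro Sp_poly_diff Sp_poly_sum Sp_poly_mult Sp_poly_power) (auto simp: level_def)
    moreover have "algebraic_over (ratfun 0) b"
      unfolding b_def using hg(3) \<alpha>(1) ratfun.algebraic_base[OF ratfun.X_closed]
      by (intro ratfun.algebraic_diff ratfun.algebraic_sum ratfun.algebraic_mult ratfun.algebraic_power)
        (auto simp: level_def)
    ultimately show ?thesis
      by (simp add: level_def)
  qed
  ultimately show ?thesis
    using that by blast
qed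

text \<open>
  The error left by \<open>level_step\<close> at \<open>t = t\<^sub>k\<^sub>+\<^sub>1\<close> is \<open>t ^ (p - 1) \<partial>t\<close> times a constant, that is, a constant
  multiple of \<open>\<partial>t\<^sub>k\<^sub>+\<^sub>2\<close>.
\<close>
lemma next_factor_exists:
  fixes b :: "'p::prime_card Rp"
  assumes b: "level k b"
  obtains h b' where "admissible_factor (Suc k) h" "level (Suc k) b'"
    "Rp_deriv h = (- (Rp_deriv (tgen (Suc k)) * b) + Rp_deriv (tgen (Suc (Suc k))) * b') * h"
proof -
  have "ord_ge 1 (tgen (Suc k) :: 'p Rp)"
    using ord_ge_mono[OF ord_ge_tgen[of "Suc k", where 'p = 'p], of 1]
      less_CARD_power[of "Suc k", where 'p = 'p] by simp
  moreover have "b \<in> Sp_poly (Suc k)" "Rp_deriv b = 0" "algebraic_over (ratfun (Suc k)) b"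
    using b Sp_poly_mono[of k "Suc k"] ratfun_mono[of k "Suc k"]
    by (auto simp: level_def intro: algebraic_over_mono)
  ultimately obtain h s g where h: "h = 1 + tgen (Suc k) * s" "s \<in> Sp_poly (Suc k)"
      "algebraic_over (ratfun (Suc k)) h" "g \<in> Sp_poly (Suc k)" "Rp_deriv g = 0"
      "algebraic_over (ratfun (Suc k)) g"
      "Rp_deriv h = - (Rp_deriv (tgen (Suc k)) * b
        + tgen (Suc k) ^ (CARD('p) - 1) * Rp_deriv (tgen (Suc k)) * g) * h"
    using level_step[OF tgen_in_Sp_poly[OF order_refl] _ tgen_in_ratfun tgen_nonzero] by blast
  have "level (Suc k) (- g)"
    using h by (auto simp: level_def Rp.d_uminus intro: Sp_poly_uminus ratfun.algebraic_uminus)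
  moreover have "Rp_deriv h =
      (- (Rp_deriv (tgen (Suc k)) * b) + Rp_deriv (tgen (Suc (Suc k))) * - g) * h"
    unfolding h(7) deriv_tgen_Suc[of "Suc k"] by (simp add: algebra_simps)
  moreover have "admissible_factor (Suc k) h"
    using h by (auto simp: admissible_factor_def)
  ultimately show ?thesis
    using that by blast
qed

section \<open>The solution as an infinite product\<close>

theorem theorem5p1:
  fixes a :: "'p::prime_card Rp"
  assumes "a \<in> ratfun 0 \<or> (a \<in> Rp_upto 0 \<and> algebraic_over (ratfun 0) a)"
    and "regular_singularity a"
    and "local_exponent a = 0"
  shows "\<exists>(h :: nat \<Rightarrow> 'p Rp) (y :: 'p Rp).
           (\<forall>k. h k \<in> {1 + fls_X ^ (CARD('p) ^ k) * wmon k * s | s. s \<in> Sp_upto k} \<and>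
                algebraic_over (ratfun k) (h k)) \<and>
           h has_prod y \<and>
           Lop a y = 0 \<and>
           poly_coeffs y \<and>
           (\<forall>i. proj i y = (\<Prod>k\<le>i. h k) \<and> algebraic_over (ratfun i) (proj i y))"
proof -
  let ?p = "CARD('p)"
  have alg_a: "algebraic_over (ratfun 0) a"
    using assms(1) ratfun.algebraic_base by blast
  have frob_a: "(a $$ n) ^ ?p = a $$ n" for n
    using assms(1) ratfun_0_frobenius Rp_upto_0_frobenius by blast
  have ord_a: "ord_ge 0 a"
    unfolding ord_ge_def
  proof (intro allI impI)
    fix n :: int assume "n < 0"
    then consider "n < -1" | "n = -1" by linarith
    then show "a $$ n = 0"
      using assms(2,3) by cases (auto simp: regular_singularity_def local_exponent_def)
  qed
  obtain h0 b0 where h0: "admissible_factor 0 h0" "level 0 b0"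
      "Rp_deriv h0 = (- a + Rp_deriv (tgen 1) * b0) * h0"
    using base_factor_exists[OF alg_a ord_a frob_a] by blast
  \<comment> \<open>the clause for \<open>k = 0\<close> makes the chosen sequence of errors start with the one left by \<open>h0\<close>\<close>
  define P where "P k b \<longleftrightarrow> level k b \<and> (k = 0 \<longrightarrow> b = b0)" for k and b :: "'p Rp"
  define Q where "Q k b b' \<longleftrightarrow> (\<exists>h. admissible_factor (Suc k) h \<and> Rp_deriv h =
      (- (Rp_deriv (tgen (Suc k)) * b) + Rp_deriv (tgen (Suc (Suc k))) * b') * h)"
    for k and b b' :: "'p Rp"
  have "\<exists>b. \<forall>k. P k (b k) \<and> Q k (b k) (b (Suc k))"
  proof (rule dependent_nat_choice)
    show "\<exists>b. P 0 b"
      using h0(2) by (auto simp: P_def)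
    show "\<exists>b'. P (Suc k) b' \<and> Q k b b'" if "P k b" for b k
      using next_factor_exists[of k b] that unfolding P_def Q_def by blast
  qed
  then obtain b where b: "\<And>k. level k (b k)" "b 0 = b0" "\<And>k. Q k (b k) (b (Suc k))"
    unfolding P_def by blast
  then obtain h' where h': "\<And>k. admissible_factor (Suc k) (h' k)"
      "\<And>k. Rp_deriv (h' k) =
        (- (Rp_deriv (tgen (Suc k)) * b k) + Rp_deriv (tgen (Suc (Suc k))) * b (Suc k)) * h' k"
    unfolding Q_def by metis
  define h where "h = case_nat h0 h'"
  have h_adm: "admissible_factor k (h k)" for k
    using h0(1) h'(1) by (cases k) (auto simp: h_def)
  obtain s where s: "\<And>k. s k \<in> Sp_poly k" "\<And>k. h k = 1 + tgen k * s k"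
    using h_adm unfolding admissible_factor_def by metis
  have h_S: "h k \<in> Sp_poly k" for k
    using s(1)[of k] tgen_in_Sp_poly[of k k] unfolding s(2) by (intro Sp_poly_intros) auto
  define Y where "Y n = (\<Prod>k\<le>n. h k)" for n
  have Y_S: "Y n \<in> Sp_poly n" for n
    unfolding Y_def using h_S Sp_poly_mono[of _ n] by (intro Sp_poly_prod) auto
  have Y_Suc: "Y (Suc n) - Y n = tgen (Suc n) * (Y n * s (Suc n))" for n
    by (simp add: Y_def s(2) algebra_simps)
  have t_ord: "ord_ge (int (Suc n)) (tgen n :: 'p Rp)" for n
    by (rule ord_ge_mono[OF ord_ge_tgen]) (use less_CARD_power[of n, where 'p = 'p] in linarith)
  have Y_step: "ord_ge (int (Suc (Suc n))) (Y (Suc n) - Y n)" for n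
    unfolding Y_Suc
    by (rule ord_ge_mult_le[OF t_ord ord_ge_mult_le[OF Sp_poly_ord_ge[OF Y_S]
          Sp_poly_ord_ge[OF s(1)], of 0]]) auto
  obtain y where y: "\<And>n. ord_ge (int n) (y - Y n)"
    using fls_limit_exists[of Y] Sp_poly_ord_ge[OF Y_S] ord_ge_mono[OF Y_step] by auto
  have "ord_ge 1 (Y n - 1)" for n
  proof (induction n)
    case 0
    show ?case
      using ord_ge_mult_le[OF t_ord[of 0] Sp_poly_ord_ge[OF s(1)[of 0]], of 1]
      by (simp add: Y_def s(2))
  next
    case (Suc n)
    then show ?case
      using ord_ge_diff_trans[of 1 "Y (Suc n)" "Y n" 1] ord_ge_mono[OF Y_step[of n], of 1] by simp
  qed
  then have "ord_ge 1 (y - 1)"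
    using ord_ge_diff_trans[of 1 y "Y 1" 1] y[of 1] by simp
  then have "y \<noteq> 0"
    by (auto simp: ord_ge_def dest: spec[of _ 0])
  have prod: "h has_prod y"
    unfolding has_prod_def raw_has_prod_def
    using fls_tendstoI[OF y] \<open>y \<noteq> 0\<close> by (simp add: Y_def)

  have Y_deriv: "Rp_deriv (Y n) = (- a + Rp_deriv (tgen (Suc n)) * b n) * Y n" for n
  proof (induction n)
    case 0
    then show ?case
      using h0(3) by (simp add: Y_def h_def b(2))
  next
    case (Suc n)
    have "Y (Suc n) = Y n * h' n"
      by (simp add: Y_def h_def)
    then show ?case
      by (simp add: Rp_deriv_mult Suc h'(2) algebra_simps)
  qed
  \<comment> \<open>the logarithmic derivative of \<open>Y n\<close> differs from \<open>- a\<close> by an error of order at least \<open>p ^ (n + 1) - 1\<close>\<close>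
  have "ord_ge (int n) (Lop a y)" for n
  proof -
    let ?r = "y - Y (Suc n)"
    have "Lop a y = Rp_deriv ?r + a * ?r + Rp_deriv (tgen (Suc (Suc n))) * (b (Suc n) * Y (Suc n))"
      by (simp add: Lop_def Rp.d_diff Y_deriv algebra_simps)
    moreover have "ord_ge (int n) (Rp_deriv ?r)"
      using ord_ge_Rp_deriv[OF y[of "Suc n"]] by simp
    moreover have "ord_ge (int n) (a * ?r)"
      by (rule ord_ge_mult_le[OF ord_a y[of "Suc n"]]) simp
    moreover have "ord_ge (int n) (Rp_deriv (tgen (Suc (Suc n))) * (b (Suc n) * Y (Suc n)))"
    proof (rule ord_ge_mult_le[OF ord_ge_Rp_deriv[OF t_ord]])
      have "b (Suc n) \<in> Sp_poly (Suc n)"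
        using b(1)[of "Suc n"] by (simp add: level_def)
      then show "ord_ge 0 (b (Suc n) * Y (Suc n))"
        using Sp_poly_ord_ge[OF Sp_poly_mult[OF _ Y_S]] by blast
    qed simp
    ultimately show ?thesis
      by (simp add: ord_ge_add)
  qed
  then have ode: "Lop a y = 0"
    by (rule ord_ge_all_imp_eq_0)

  have y_nth: "y $$ m = Y n $$ m" if "m < int n" for m n
    using y[of n] that by (simp add: ord_ge_def)
  have y_coeffs: "poly_coeffs y"
    unfolding poly_coeffs_def
  proof
    fix m
    have "y $$ m = Y (nat (m + 1)) $$ m"
      by (rule y_nth) simp
    also have "\<dots> \<in> range to_fract"
      using Sp_poly_poly_coeffs[OF Y_S] by (simp add: poly_coeffs_def)
    finally show "y $$ m \<in> range to_fract" .
  qed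
  have proj_h: "proj i (h k) = (if k \<le> i then h k else 1)" for i k
  proof (cases "k \<le> i")
    case True
    then show ?thesis
      using h_S[of k] Sp_poly_mono[of k i] by (auto intro: proj_Sp_poly)
  next
    case False
    have pc: "poly_coeffs (1 :: 'p Rp)" "poly_coeffs (tgen k :: 'p Rp)" "poly_coeffs (s k)"
        "poly_coeffs (tgen k * s k)"
      using s(1)[of k] by (auto intro!: Sp_poly_poly_coeffs[of _ k] Sp_poly_intros tgen_in_Sp_poly)
    then have "proj i (h k) = proj i 1 + proj i (tgen k) * proj i (s k)"
      by (simp add: s(2) proj_add proj_mult)
    then show ?thesis
      using False by (simp add: proj_tgen proj_Sp_poly[OF Sp_poly_one])
  qed
  have proj_Y: "proj i (Y n) = Y i" if "i \<le> n" for i n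
  proof -
    have "proj i (Y n) = (\<Prod>k\<le>n. proj i (h k))"
      unfolding Y_def using h_S Sp_poly_mono[of _ n] by (intro proj_prod[where k = n]) auto
    also have "\<dots> = (\<Prod>k\<in>{..n}. if k \<in> {..i} then h k else 1)"
      by (simp add: proj_h)
    also have "\<dots> = (\<Prod>k\<in>{..n} \<inter> {..i}. h k)"
      by (rule prod.inter_restrict[symmetric]) simp
    also have "{..n} \<inter> {..i} = {..i}"
      using that by auto
    finally show ?thesis
      by (simp add: Y_def)
  qed
  have proj_y: "proj i y = Y i" for i
  proof (rule fls_eqI)
    fix m
    let ?n = "max i (nat (m + 1))"
    have "proj i y $$ m = proj i (Y ?n) $$ m"
      using y_nth[of m ?n] by (simp add: proj_nth)
    then show "proj i y $$ m = Y i $$ m"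
      by (simp add: proj_Y)
  qed
  have alg_Y: "algebraic_over (ratfun i) (Y i)" for i
    unfolding Y_def using h_adm ratfun_mono[of _ i]
    by (intro ratfun.algebraic_prod) (auto simp: admissible_factor_def intro: algebraic_over_mono)
  show ?thesis
  proof (intro exI[of _ h] exI[of _ y] conjI allI)
    fix k
    show "h k \<in> {1 + fls_X ^ (?p ^ k) * wmon k * s | s. s \<in> Sp_upto k}"
      using s[of k] Sp_poly_subset[of k] by (auto simp: tgen_def)
    show "algebraic_over (ratfun k) (h k)"
      using h_adm by (simp add: admissible_factor_def)
    show "proj k y = (\<Prod>i\<le>k. h i)"
      by (simp add: proj_y Y_def)
    show "algebraic_over (ratfun k) (proj k y)"
      by (simp add: proj_y alg_Y)
  qed (rule prod ode y_coeffs)+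
qed

end
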